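(* Let $A\in\mathbb{C}^{2\times2}$ and suppose there exists a non-singular real diagonal $2\times2$ matrix $B$ such that $\|AB-I\|<1$. Let $\omega=\arcsin(\|AB-I\|)$ with $0\le\omega<\pi/2$. Then $$\mathrm{Spec}(AD)\subset S(-\omega,\omega)\cup S(-\pi-\omega,\omega-\pi)$$ and for any small enough $\varepsilon>0$ there exists $k_\varepsilon>0$ independent of $z$ such that $$\|(AD-z)^{-1}\|\le\frac{k_\varepsilon}{|z|}$$ for all $z\notin S(-\omega-\varepsilon,\omega+\varepsilon)\cup S(-\pi-\omega-\varepsilon,\omega-\pi+\varepsilon)$.
   Context: Let $W^{2,2}$ be the Sobolev space of all $f\in L^2(0,1)\otimes\mathbb{C}^2$ whose generalized derivative $f''$ lies in $L^2(0,1)\otimes\mathbb{C}^2$, and write $f=\begin{pmatrix}\phi\\ \gamma\end{pmatrix}$. The operator $D$ acts on $L^2(0,1)\otimes\mathbb{C}^2$ by $Df=-f''$ with domain $\mathrm{Dom}(D)=\{f\in W^{2,2}:\phi(0)=\phi(1)=0,\ \gamma'(0)=\gamma'(1)=0\}$. $AD$ is the operator $f\mapsto -Af''$ with domain $\mathrm{Dom}(D)$. $\mathrm{Spec}$ denotes the spectrum; the norm of a matrix is its operator norm on $\mathbb{C}^2$ with the Euclidean norm. For real $\alpha\le\beta$, $S(\alpha,\beta)=\{z\in\mathbb{C}:\alpha\le\arg z\le\beta\}$, where $\arg z$ may be any determination of the argument (it is taken modulo $2\pi$) and $0$ is counted as an element of $S(\alpha,\beta)$. *)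

theory Defs
  imports "HOL-Analysis.Analysis"
begin

abbreviation unit_leb :: "real measure" where
  "unit_leb \<equiv> lebesgue_on {0<..<1}"

definition sq_integrable :: "(real \<Rightarrow> complex^2) \<Rightarrow> bool" where
  "sq_integrable f \<longleftrightarrow>
     f \<in> borel_measurable unit_leb \<and> integrable unit_leb (\<lambda>x. (norm (f x))\<^sup>2)"

definition L2_eq :: "(real \<Rightarrow> complex^2) \<Rightarrow> (real \<Rightarrow> complex^2) \<Rightarrow> bool" where
  "L2_eq f g \<longleftrightarrow> sq_integrable f \<and> sq_integrable g \<and> (AE x in unit_leb. f x = g x)"

lemma sq_integrable_measurable: "sq_integrable f \<Longrightarrow> f \<in> borel_measurable unit_leb"
  by (simp add: sq_integrable_def)

lemma sq_integrable_0: "sq_integrable (\<lambda>x. 0)"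
  by (simp add: sq_integrable_def)

lemma sq_integrable_bounded_by:
  assumes f: "sq_integrable f" and g: "g \<in> borel_measurable unit_leb"
    and le: "\<And>x. norm (g x) \<le> c * norm (f x)"
  shows "sq_integrable g"
proof -
  have "integrable unit_leb (\<lambda>x. c\<^sup>2 * (norm (f x))\<^sup>2)"
    using f by (simp add: sq_integrable_def)
  moreover have "(\<lambda>x. (norm (g x))\<^sup>2) \<in> borel_measurable unit_leb"
    using g by measurable
  moreover have "(norm (g x))\<^sup>2 \<le> c\<^sup>2 * (norm (f x))\<^sup>2" for x
    using power_mono[OF le[of x], of 2] by (simp add: power_mult_distrib)
  ultimately have "integrable unit_leb (\<lambda>x. (norm (g x))\<^sup>2)"
    by (elim Bochner_Integration.integrable_bound) auto
  then show ?thesis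
    using g by (simp add: sq_integrable_def)
qed

lemma sq_integrable_add:
  assumes f: "sq_integrable f" and g: "sq_integrable g"
  shows "sq_integrable (\<lambda>x. f x + g x)"
proof -
  have [measurable]: "f \<in> borel_measurable unit_leb" "g \<in> borel_measurable unit_leb"
    using f g by (simp_all add: sq_integrable_def)
  have "integrable unit_leb (\<lambda>x. 2 * (norm (f x))\<^sup>2 + 2 * (norm (g x))\<^sup>2)"
    using f g by (simp add: sq_integrable_def)
  moreover have "(\<lambda>x. (norm (f x + g x))\<^sup>2) \<in> borel_measurable unit_leb"
    by measurable
  moreover have "(norm (f x + g x))\<^sup>2 \<le> 2 * (norm (f x))\<^sup>2 + 2 * (norm (g x))\<^sup>2" for x
  proof -
    have "(norm (f x + g x))\<^sup>2 \<le> (norm (f x) + norm (g x))\<^sup>2"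
      by (simp add: norm_triangle_ineq power_mono)
    also have "\<dots> \<le> 2 * (norm (f x))\<^sup>2 + 2 * (norm (g x))\<^sup>2"
      using zero_le_power2[of "norm (f x) - norm (g x)"]
      by (simp add: power2_eq_square algebra_simps)
    finally show ?thesis .
  qed
  ultimately have "integrable unit_leb (\<lambda>x. (norm (f x + g x))\<^sup>2)"
    by (elim Bochner_Integration.integrable_bound) auto
  then show ?thesis
    by (simp add: sq_integrable_def)
qed

lemma sq_integrable_scaleR:
  "sq_integrable f \<Longrightarrow> sq_integrable (\<lambda>x. c *\<^sub>R f x)"
  by (rule sq_integrable_bounded_by[of f _ "\<bar>c\<bar>"]) (auto dest: sq_integrable_measurable)

lemma sq_integrable_minus: "sq_integrable f \<Longrightarrow> sq_integrable (\<lambda>x. - f x)"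
  using sq_integrable_scaleR[of f "-1"] by simp

lemma sq_integrable_diff:
  "sq_integrable f \<Longrightarrow> sq_integrable g \<Longrightarrow> sq_integrable (\<lambda>x. f x - g x)"
  using sq_integrable_add[of f "\<lambda>x. - g x"] sq_integrable_minus[of g] by simp

lemma sq_integrable_bounded_linear:
  assumes f: "sq_integrable f" and T: "bounded_linear T"
  shows "sq_integrable (\<lambda>x. T (f x))"
proof -
  have "T \<in> borel_measurable borel"
    using T by (intro borel_measurable_continuous_onI linear_continuous_on)
  then have "(\<lambda>x. T (f x)) \<in> borel_measurable unit_leb"
    using sq_integrable_measurable[OF f] by measurable
  then show ?thesis
    using onorm[OF T] by (intro sq_integrable_bounded_by[OF f]) auto
qed

lemma bounded_linear_scale_vec: "bounded_linear (\<lambda>v :: complex^2. c *s v)"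
proof -
  have eq: "(\<lambda>v :: complex^2. c *s v) = (\<lambda>v. \<chi> i. c * v $ i)"
    by (simp add: fun_eq_iff vector_scalar_mult_def)
  have "linear (\<lambda>v :: complex^2. c *s v)"
    unfolding eq by (intro linearI) (simp_all add: vec_eq_iff algebra_simps)
  then show ?thesis
    by (rule linear_conv_bounded_linear[THEN iffD1])
qed

lemma bounded_linear_matrix_vec: "bounded_linear (\<lambda>v. (A :: complex^2^2) *v v)"
proof -
  have "linear (\<lambda>v. (A :: complex^2^2) *v v)"
    by (intro linearI)
      (simp_all add: matrix_vector_right_distrib,
        simp add: vec_eq_iff matrix_vector_mult_def scaleR_sum_right)
  then show ?thesis
    by (rule linear_conv_bounded_linear[THEN iffD1])
qed

lemma sq_integrable_inner:
  assumes f: "sq_integrable f" and g: "sq_integrable g"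
  shows "integrable unit_leb (\<lambda>x. f x \<bullet> g x)"
proof -
  have [measurable]: "f \<in> borel_measurable unit_leb" "g \<in> borel_measurable unit_leb"
    using f g by (simp_all add: sq_integrable_def)
  have "integrable unit_leb (\<lambda>x. (norm (f x))\<^sup>2 + (norm (g x))\<^sup>2)"
    using f g by (simp add: sq_integrable_def)
  moreover have "(\<lambda>x. f x \<bullet> g x) \<in> borel_measurable unit_leb"
    by measurable
  moreover have "\<bar>f x \<bullet> g x\<bar> \<le> (norm (f x))\<^sup>2 + (norm (g x))\<^sup>2" for x
  proof -
    have "\<bar>f x \<bullet> g x\<bar> \<le> norm (f x) * norm (g x)"
      by (rule Cauchy_Schwarz_ineq2)
    also have "\<dots> \<le> (norm (f x))\<^sup>2 + (norm (g x))\<^sup>2"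
      using zero_le_power2[of "norm (f x) - norm (g x)"]
        mult_nonneg_nonneg[OF norm_ge_zero[of "f x"] norm_ge_zero[of "g x"]]
      by (simp only: power2_diff)
    finally show ?thesis .
  qed
  ultimately show ?thesis
    by (elim Bochner_Integration.integrable_bound) auto
qed

lemma part_equivp_L2_eq: "part_equivp L2_eq"
proof (rule part_equivpI)
  show "\<exists>f. L2_eq f f"
    by (rule exI[of _ "\<lambda>x. 0"]) (simp add: L2_eq_def sq_integrable_0)
  show "symp L2_eq"
    by (auto simp: symp_def L2_eq_def elim: AE_mp)
  show "transp L2_eq"
  proof (rule transpI)
    fix f g h assume "L2_eq f g" "L2_eq g h"
    moreover from this have "AE x in unit_leb. f x = g x" "AE x in unit_leb. g x = h x"
      by (simp_all add: L2_eq_def)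
    then have "AE x in unit_leb. f x = h x"
      by eventually_elim simp
    ultimately show "L2_eq f h"
      by (simp add: L2_eq_def)
  qed
qed

quotient_type L2 = "real \<Rightarrow> complex^2" / partial: L2_eq
  by (rule part_equivp_L2_eq)

instantiation L2 :: real_inner
begin

lift_definition zero_L2 :: L2 is "\<lambda>x. 0"
  by (simp add: L2_eq_def sq_integrable_0)

lift_definition plus_L2 :: "L2 \<Rightarrow> L2 \<Rightarrow> L2" is "\<lambda>f g x. f x + g x"
  unfolding L2_eq_def by (auto intro: sq_integrable_add)

lift_definition uminus_L2 :: "L2 \<Rightarrow> L2" is "\<lambda>f x. - f x"
  unfolding L2_eq_def by (auto intro: sq_integrable_minus)

lift_definition minus_L2 :: "L2 \<Rightarrow> L2 \<Rightarrow> L2" is "\<lambda>f g x. f x - g x"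
  unfolding L2_eq_def by (auto intro: sq_integrable_diff)

lift_definition scaleR_L2 :: "real \<Rightarrow> L2 \<Rightarrow> L2" is "\<lambda>c f x. c *\<^sub>R f x"
  unfolding L2_eq_def by (auto intro: sq_integrable_scaleR)

(* The real part of the Hermitian inner product; it induces the usual norm. *)
lift_definition inner_L2 :: "L2 \<Rightarrow> L2 \<Rightarrow> real" is
  "\<lambda>f g. \<integral>x. f x \<bullet> g x \<partial>unit_leb"
proof -
  fix f f' g g' assume "L2_eq f f'" "L2_eq g g'"
  then have m: "f \<in> borel_measurable unit_leb" "f' \<in> borel_measurable unit_leb"
      "g \<in> borel_measurable unit_leb" "g' \<in> borel_measurable unit_leb"
    and ae: "AE x in unit_leb. f x = f' x" "AE x in unit_leb. g x = g' x"
    by (auto simp: L2_eq_def sq_integrable_def)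
  show "(\<integral>x. f x \<bullet> g x \<partial>unit_leb) = (\<integral>x. f' x \<bullet> g' x \<partial>unit_leb)"
  proof (rule integral_cong_AE)
    show "AE x in unit_leb. f x \<bullet> g x = f' x \<bullet> g' x"
      using ae by eventually_elim simp
  qed (use m in measurable)
qed

lift_definition norm_L2 :: "L2 \<Rightarrow> real" is
  "\<lambda>f. sqrt (\<integral>x. (norm (f x))\<^sup>2 \<partial>unit_leb)"
proof -
  fix f f' assume "L2_eq f f'"
  then have m: "f \<in> borel_measurable unit_leb" "f' \<in> borel_measurable unit_leb"
    and ae: "AE x in unit_leb. f x = f' x"
    by (auto simp: L2_eq_def sq_integrable_def)
  have "(\<integral>x. (norm (f x))\<^sup>2 \<partial>unit_leb) = (\<integral>x. (norm (f' x))\<^sup>2 \<partial>unit_leb)"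
  proof (rule integral_cong_AE)
    show "AE x in unit_leb. (norm (f x))\<^sup>2 = (norm (f' x))\<^sup>2"
      using ae by eventually_elim simp
  qed (use m in measurable)
  then show "sqrt (\<integral>x. (norm (f x))\<^sup>2 \<partial>unit_leb) = sqrt (\<integral>x. (norm (f' x))\<^sup>2 \<partial>unit_leb)"
    by simp
qed

definition dist_L2 :: "L2 \<Rightarrow> L2 \<Rightarrow> real" where
  "dist_L2 f g = norm (f - g)"

definition sgn_L2 :: "L2 \<Rightarrow> L2" where
  "sgn_L2 f = inverse (norm f) *\<^sub>R f"

definition uniformity_L2 :: "(L2 \<times> L2) filter" where
  "uniformity_L2 = (INF e\<in>{0<..}. principal {(f, g). dist f g < e})"

definition open_L2 :: "L2 set \<Rightarrow> bool" where
  "open_L2 U \<longleftrightarrow> (\<forall>f\<in>U. eventually (\<lambda>(f', g). f' = f \<longrightarrow> g \<in> U) uniformity)"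

instance
proof
  fix f g h :: L2 and a b :: real
  show "f + g + h = f + (g + h)"
    by transfer (auto simp: L2_eq_def add.assoc intro!: sq_integrable_add)
  show "f + g = g + f"
    by transfer (auto simp: L2_eq_def add.commute intro!: sq_integrable_add)
  show "0 + f = f"
    by transfer (auto simp: L2_eq_def)
  show "- f + f = 0"
    by transfer (auto simp: L2_eq_def sq_integrable_0)
  show "f - g = f + - g"
    by transfer (auto simp: L2_eq_def intro!: sq_integrable_diff)
  show "a *\<^sub>R (f + g) = a *\<^sub>R f + a *\<^sub>R g"
    by transfer
      (auto simp: L2_eq_def scaleR_add_right intro!: sq_integrable_add sq_integrable_scaleR)
  show "(a + b) *\<^sub>R f = a *\<^sub>R f + b *\<^sub>R f"
    by transfer
      (auto simp: L2_eq_def scaleR_add_left intro!: sq_integrable_add sq_integrable_scaleR)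
  show "a *\<^sub>R b *\<^sub>R f = (a * b) *\<^sub>R f"
    by transfer (auto simp: L2_eq_def intro!: sq_integrable_scaleR)
  show "1 *\<^sub>R f = f"
    by transfer (auto simp: L2_eq_def)
  show "sgn f = inverse (norm f) *\<^sub>R f"
    by (rule sgn_L2_def)
  show "dist f g = norm (f - g)"
    by (rule dist_L2_def)
  show "(uniformity :: (L2 \<times> L2) filter) = (INF e\<in>{0<..}. principal {(f, g). dist f g < e})"
    by (rule uniformity_L2_def)
  show "open U \<longleftrightarrow> (\<forall>f\<in>U. eventually (\<lambda>(f', g). f' = f \<longrightarrow> g \<in> U) uniformity)" for U :: "L2 set"
    by (rule open_L2_def)
  show "f \<bullet> g = g \<bullet> f"
    by transfer (simp add: inner_commute)
  show "(f + g) \<bullet> h = f \<bullet> h + g \<bullet> h"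
    by transfer (simp add: L2_eq_def inner_add_left sq_integrable_inner)
  show "(a *\<^sub>R f) \<bullet> g = a * (f \<bullet> g)"
    by transfer simp
  show "0 \<le> f \<bullet> f"
    by transfer simp
  show "f \<bullet> f = 0 \<longleftrightarrow> f = 0"
  proof transfer
    fix f assume "L2_eq f f"
    then have f: "sq_integrable f"
      by (simp add: L2_eq_def)
    have "(\<integral>x. f x \<bullet> f x \<partial>unit_leb) = 0 \<longleftrightarrow> (AE x in unit_leb. f x \<bullet> f x = 0)"
      by (rule integral_nonneg_eq_0_iff_AE[OF sq_integrable_inner[OF f f]]) simp
    then show "(\<integral>x. f x \<bullet> f x \<partial>unit_leb) = 0 \<longleftrightarrow> L2_eq f (\<lambda>x. 0)"
      using f by (simp add: L2_eq_def sq_integrable_0)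
  qed
  show "norm f = sqrt (f \<bullet> f)"
    by transfer (simp add: power2_norm_eq_inner)
qed

end

lift_definition scaleC_L2 :: "complex \<Rightarrow> L2 \<Rightarrow> L2" is "\<lambda>c f x. c *s f x"
  unfolding L2_eq_def by (auto intro: sq_integrable_bounded_linear bounded_linear_scale_vec)

lift_definition matrix_L2 :: "complex^2^2 \<Rightarrow> L2 \<Rightarrow> L2" is "\<lambda>A f x. A *v f x"
  unfolding L2_eq_def by (auto intro: sq_integrable_bounded_linear bounded_linear_matrix_vec)

lift_definition represented_by :: "L2 \<Rightarrow> (real \<Rightarrow> complex^2) \<Rightarrow> bool" is
  "\<lambda>f F. sq_integrable F \<and> (AE x in unit_leb. f x = F x)"
proof -
  fix f f' assume "L2_eq f f'"
  then have ae: "AE x in unit_leb. f x = f' x"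
    by (simp add: L2_eq_def)
  have "(AE x in unit_leb. f x = F x) \<longleftrightarrow> (AE x in unit_leb. f' x = F x)" for F
    by (rule eventually_cong[OF ae]) simp
  then show "(\<lambda>F. sq_integrable F \<and> (AE x in unit_leb. f x = F x)) =
      (\<lambda>F. sq_integrable F \<and> (AE x in unit_leb. f' x = F x))"
    by simp
qed

definition test_function :: "(real \<Rightarrow> real) \<Rightarrow> bool" where
  "test_function u \<longleftrightarrow>
     (\<forall>n. (deriv ^^ n) u differentiable_on UNIV) \<and>
     (\<exists>a b. 0 < a \<and> b < 1 \<and> (\<forall>x. x \<notin> {a..b} \<longrightarrow> u x = 0))"

lemma test_function_measurable:
  assumes "test_function u"
  shows "(deriv ^^ n) u \<in> borel_measurable unit_leb"
proof -
  have "continuous_on UNIV ((deriv ^^ n) u)"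
    using assms by (simp add: test_function_def differentiable_imp_continuous_on)
  then have "(deriv ^^ n) u \<in> borel_measurable borel"
    by (rule borel_measurable_continuous_onI)
  then show ?thesis
    by (intro measurable_restrict_space1 measurable_completion) simp
qed

(* g is the generalized (distributional) derivative of order n of f on (0,1). *)
lift_definition has_weak_deriv :: "nat \<Rightarrow> L2 \<Rightarrow> L2 \<Rightarrow> bool" is
  "\<lambda>n f g. \<forall>u. test_function u \<longrightarrow>
     (\<integral>x. (deriv ^^ n) u x *\<^sub>R f x \<partial>unit_leb) = (-1) ^ n *\<^sub>R (\<integral>x. u x *\<^sub>R g x \<partial>unit_leb)"
proof -
  fix n f f' g g' assume eq: "L2_eq f f'" "L2_eq g g'"
  have cong: "(\<integral>x. (deriv ^^ k) u x *\<^sub>R h x \<partial>unit_leb) = (\<integral>x. (deriv ^^ k) u x *\<^sub>R h' x \<partial>unit_leb)"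
    if hh': "L2_eq h h'" and u: "test_function u" for k u h h'
  proof (rule integral_cong_AE)
    have m: "h \<in> borel_measurable unit_leb" "h' \<in> borel_measurable unit_leb"
      and ae: "AE x in unit_leb. h x = h' x"
      using hh' by (auto simp: L2_eq_def sq_integrable_def)
    show "(\<lambda>x. (deriv ^^ k) u x *\<^sub>R h x) \<in> borel_measurable unit_leb"
      "(\<lambda>x. (deriv ^^ k) u x *\<^sub>R h' x) \<in> borel_measurable unit_leb"
      using m test_function_measurable[OF u, of k] by (auto intro: borel_measurable_scaleR)
    show "AE x in unit_leb. (deriv ^^ k) u x *\<^sub>R h x = (deriv ^^ k) u x *\<^sub>R h' x"
      using ae by eventually_elim simp
  qed
  show "(\<forall>u. test_function u \<longrightarrow>
      (\<integral>x. (deriv ^^ n) u x *\<^sub>R f x \<partial>unit_leb) = (-1) ^ n *\<^sub>R (\<integral>x. u x *\<^sub>R g x \<partial>unit_leb)) \<longleftrightarrow>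
    (\<forall>u. test_function u \<longrightarrow>
      (\<integral>x. (deriv ^^ n) u x *\<^sub>R f' x \<partial>unit_leb) = (-1) ^ n *\<^sub>R (\<integral>x. u x *\<^sub>R g' x \<partial>unit_leb))"
    using cong[OF eq(1)] cong[OF eq(2), of _ 0] by auto
qed

definition W22 :: "L2 set" where
  "W22 = {f. \<exists>g. has_weak_deriv 2 f g}"

definition weak_deriv2 :: "L2 \<Rightarrow> L2" where
  "weak_deriv2 f = (THE g. has_weak_deriv 2 f g)"

(* Boundary values of an element of W22 are those of its continuously
   differentiable representative F on [0,1]; the derivatives at the end points are one-sided. *)
definition Dom_D :: "L2 set" where
  "Dom_D = {f \<in> W22. \<exists>F F'. represented_by f F \<and>
     (\<forall>x\<in>{0..1}. (F has_vector_derivative F' x) (at x within {0..1})) \<and>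
     continuous_on {0..1} F' \<and>
     F 0 $ 1 = 0 \<and> F 1 $ 1 = 0 \<and> F' 0 $ 2 = 0 \<and> F' 1 $ 2 = 0}"

(* The values of the operators outside Dom_D are irrelevant. *)
definition op_D :: "L2 \<Rightarrow> L2" where
  "op_D f = - weak_deriv2 f"

definition op_AD :: "complex^2^2 \<Rightarrow> L2 \<Rightarrow> L2" where
  "op_AD A f = matrix_L2 A (op_D f)"

definition resolvent :: "L2 set \<Rightarrow> (L2 \<Rightarrow> L2) \<Rightarrow> complex \<Rightarrow> L2 \<Rightarrow> L2" where
  "resolvent Dom T z = inv_into Dom (\<lambda>f. T f - scaleC_L2 z f)"

(* For complex linear T the inverse of a bijective T - z is complex linear, so
   requiring it to be real bounded linear amounts to boundedness. *)
definition resolvent_set :: "L2 set \<Rightarrow> (L2 \<Rightarrow> L2) \<Rightarrow> complex set" where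
  "resolvent_set Dom T =
     {z. bij_betw (\<lambda>f. T f - scaleC_L2 z f) Dom UNIV \<and> bounded_linear (resolvent Dom T z)}"

definition Spec :: "L2 set \<Rightarrow> (L2 \<Rightarrow> L2) \<Rightarrow> complex set" where
  "Spec Dom T = - resolvent_set Dom T"

definition sector :: "real \<Rightarrow> real \<Rightarrow> complex set" where
  "sector \<alpha> \<beta> = {z. z = 0 \<or> (\<exists>\<theta>. \<alpha> \<le> \<theta> \<and> \<theta> \<le> \<beta> \<and> is_Arg z \<theta>)}"

definition real_diagonal :: "complex^2^2 \<Rightarrow> bool" where
  "real_diagonal B \<longleftrightarrow> (\<forall>i j. B $ i $ j \<in> \<real> \<and> (i \<noteq> j \<longrightarrow> B $ i $ j = 0))"

definition matrix_norm :: "complex^2^2 \<Rightarrow> real" where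
  "matrix_norm M = onorm (\<lambda>v. M *v v)"

end

theory Submission
  imports Defs "HOL-Computational_Algebra.Polynomial"
begin

text \<open>
  Write \<open>A B = I + C\<close>, \<open>s = \<parallel>C\<parallel> = sin \<omega>\<close> and \<open>H = B\<^sup>-\<^sup>1 D\<close>, so that \<open>A D = (I + C) H\<close>. As \<open>B\<close> is real and
  diagonal, the boundary conditions make \<open>H\<close> symmetric, whence
  \<open>\<bar>Im z\<bar> \<parallel>f\<parallel>\<close> and \<open>\<bar>Im z\<bar> \<parallel>H f\<parallel> / \<bar>z\<bar>\<close> are both at most \<open>\<parallel>(H - z) f\<parallel>\<close>. Treating \<open>C H\<close> as a perturbation gives
  \<open>(\<bar>Im z\<bar> - s \<bar>z\<bar>) \<parallel>f\<parallel> \<le> \<parallel>(A D - z) f\<parallel>\<close>, and outside the two sectors the factor is positive.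
  This yields injectivity and the resolvent bound. Surjectivity needs no spectral theory:
  \<open>- A f'' - z f = g\<close> is a linear ODE, and by injectivity the \<open>2 \<times> 2\<close> system for the free initial
  data that expresses the boundary conditions at \<open>1\<close> is uniquely solvable.
\<close>

section \<open>Smooth functions\<close>

text \<open>\<open>C H\<close> is unbounded, so a bound on \<open>f\<close> alone could not absorb
  it; the bound on \<open>H f\<close> does. It is the elementary counterpart of the supremum of |t /
  (t - z)| over real t, which is |z| / |Im z|. Both bounds come from one quadratic form in the norms
  of \<open>H f\<close> and \<open>f\<close>, by completing the square in either variable.
  \<open>L2\<close> is a real inner product space, so symmetry of \<open>H\<close> enters as
  orthogonality of \<open>H f\<close> and \<open>\<i> f\<close>. The domain is described by
  distributional derivatives, while boundary terms and initial data need pointwise ones. The bridge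
  is the du Bois-Reymond lemma: the derivative of the continuously differentiable representative is
  an indefinite integral of the weak second derivative. It makes integration by parts exact and lets
  solutions of the ODE be recognised as elements of the domain. The constant in the resolvent bound
  is the reciprocal of sin(\<omega> + \<epsilon>) - sin \<omega>.\<close>

abbreviation smooth :: "(real \<Rightarrow> real) \<Rightarrow> bool" where
  "smooth f \<equiv> \<forall>n. (deriv ^^ n) f differentiable_on UNIV"

lemma smooth_iff_deriv:
  "smooth f \<longleftrightarrow> (\<forall>x. f field_differentiable at x) \<and> smooth (deriv f)"
proof -
  have "smooth f \<longleftrightarrow> f differentiable_on UNIV \<and> (\<forall>n. (deriv ^^ Suc n) f differentiable_on UNIV)"
    by (metis funpow_0 not0_implies_Suc)
  then show ?thesis
    by (simp add: funpow_swap1 differentiable_on_def field_differentiable_def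
        real_differentiable_def)
qed

text \<open>All iterated derivatives stay inside a class that is closed under differentiation.
  Exhibiting such a class replaces explicit formulas for higher derivatives.\<close>

lemma smooth_coinduct:
  assumes "P f" and step: "\<And>f. P f \<Longrightarrow> \<exists>f'. P f' \<and> (\<forall>x. (f has_real_derivative f' x) (at x))"
  shows "smooth f"
proof
  fix n
  have "\<exists>f'. P f' \<and> (deriv ^^ n) f = f'"
  proof (induction n)
    case 0
    then show ?case using \<open>P f\<close> by simp
  next
    case (Suc n)
    then obtain f' where f': "P f'" "\<forall>x. ((deriv ^^ n) f has_real_derivative f' x) (at x)"
      using step by metis
    then have "deriv ((deriv ^^ n) f) = f'"
      by (simp add: DERIV_imp_deriv fun_eq_iff)
    then show ?case using f' by simp
  qed
  then obtain f' where "\<forall>x. ((deriv ^^ n) f has_real_derivative f' x) (at x)"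
    using step by metis
  then show "(deriv ^^ n) f differentiable_on UNIV"
    by (auto simp: differentiable_on_def real_differentiable_def)
qed

lemma smooth_has_deriv:
  assumes "smooth f"
  shows "(f has_real_derivative deriv f x) (at x)" "smooth (deriv f)"
  using assms smooth_iff_deriv[of f] by (auto simp: DERIV_deriv_iff_field_differentiable)

lemma smooth_continuous: "smooth f \<Longrightarrow> continuous_on S f"
  by (metis DERIV_continuous_on has_field_derivative_at_within smooth_has_deriv(1))

text \<open>Sums, products and affine substitutions are put into one class because the product rule
  produces sums of products; the joint closure is stable under differentiation, as
  \<open>smooth_coinduct\<close> demands. The case \<open>c = 1\<close>, \<open>d = 0\<close> of
  \<open>affine\<close> contains the smooth functions themselves.\<close>

inductive smooth_alg :: "(real \<Rightarrow> real) \<Rightarrow> bool" where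
  affine: "smooth f \<Longrightarrow> smooth_alg (\<lambda>x. f (c * x + d))"
| const: "smooth_alg (\<lambda>x. c)"
| add: "smooth_alg f \<Longrightarrow> smooth_alg g \<Longrightarrow> smooth_alg (\<lambda>x. f x + g x)"
| mult: "smooth_alg f \<Longrightarrow> smooth_alg g \<Longrightarrow> smooth_alg (\<lambda>x. f x * g x)"

lemma smooth_alg_imp_smooth:
  assumes "smooth_alg f"
  shows "smooth f"
proof (rule smooth_coinduct[where P = smooth_alg, OF assms])
  fix f assume "smooth_alg f"
  then show "\<exists>f'. smooth_alg f' \<and> (\<forall>x. (f has_real_derivative f' x) (at x))"
  proof induction
    case (affine f c d)
    have "((\<lambda>x. f (c * x + d)) has_real_derivative c * deriv f (c * x + d)) (at x)" for x
    proof -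
      have "((\<lambda>x. c * x + d) has_real_derivative c) (at x)"
        by (auto intro!: derivative_eq_intros)
      from DERIV_chain2[OF smooth_has_deriv(1)[OF affine] this] show ?thesis
        by (simp add: mult.commute)
    qed
    then show ?case
      using smooth_alg.affine[OF smooth_has_deriv(2)[OF affine]] smooth_alg.const smooth_alg.mult
      by blast
  next
    case (const c)
    then show ?case by (auto intro!: exI[of _ "\<lambda>x. 0"] smooth_alg.const)
  next
    case (add f g)
    then obtain f' g' where "smooth_alg f'" "smooth_alg g'"
      "\<And>x. (f has_real_derivative f' x) (at x)" "\<And>x. (g has_real_derivative g' x) (at x)"
      by blast
    then show ?case
      by (intro exI[of _ "\<lambda>x. f' x + g' x"]) (auto intro: smooth_alg.add derivative_intros)
  next
    case (mult f g)
    then obtain f' g' where "smooth_alg f'" "smooth_alg g'"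
      "\<And>x. (f has_real_derivative f' x) (at x)" "\<And>x. (g has_real_derivative g' x) (at x)"
      by blast
    then show ?case using mult.hyps
      by (intro exI[of _ "\<lambda>x. f' x * g x + g' x * f x"])
        (auto intro: smooth_alg.intros derivative_intros)
  qed
qed

lemma smooth_diff_scale:
  assumes "smooth f" "smooth g"
  shows "smooth (\<lambda>x. f x - c * g x)"
  using smooth_alg_imp_smooth[OF smooth_alg.add[OF smooth_alg.affine[OF assms(1), of 1 0]
    smooth_alg.mult[OF smooth_alg.const[of "-c"] smooth_alg.affine[OF assms(2), of 1 0]]]]
  by simp

text \<open>Every derivative is a polynomial in 1/x times exp(-1/x) on the right half-line and zero
  elsewhere; these functions form the class for the coinduction.\<close>

lemma smooth_flat:
  "smooth (\<lambda>x. if x > 0 then exp (- 1 / x) else 0)"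
proof (rule smooth_coinduct[where P="\<lambda>h. \<exists>p. h = (\<lambda>x. if x > 0 then poly p (1 / x) * exp (- 1 / x) else 0)"])
  show "\<exists>p. (\<lambda>x::real. if x > 0 then exp (- 1 / x) else 0) = (\<lambda>x. if x > 0 then poly p (1 / x) * exp (- 1 / x) else 0)"
    by (rule exI[of _ "[:1:]"]) (simp add: fun_eq_iff)
next
  fix h :: "real \<Rightarrow> real"
  assume "\<exists>p. h = (\<lambda>x. if x > 0 then poly p (1 / x) * exp (- 1 / x) else 0)"
  then obtain p where h: "h = (\<lambda>x. if x > 0 then poly p (1 / x) * exp (- 1 / x) else 0)"
    by blast
  \<comment> \<open>With y = 1/x, differentiating p(y) exp(-y) in x gives y^2 (p(y) - p'(y))
    exp(-y).\<close>
  define q where "q = [:0, 0, 1:] * (p - pderiv p)"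
  have "(h has_real_derivative (if x > 0 then poly q (1 / x) * exp (- 1 / x) else 0)) (at x)" for x
  proof -
    consider "x > 0" | "x < 0" | "x = 0" by linarith
    then show ?thesis
    proof cases
      case 1
      have "((\<lambda>x. poly p (1 / x) * exp (- 1 / x)) has_real_derivative poly q (1 / x) * exp (- 1 / x)) (at x)"
        using 1 by (auto intro!: derivative_eq_intros DERIV_chain'[OF _ poly_DERIV]
            simp: q_def field_simps power2_eq_square)
      then have "(h has_real_derivative poly q (1 / x) * exp (- 1 / x)) (at x)"
        by (rule has_field_derivative_transform_within_open[of _ _ _ "{0<..}"]) (use 1 in \<open>auto simp: h\<close>)
      then show ?thesis using 1 by simp
    next
      case 2
      have "((\<lambda>x. 0) has_real_derivative 0) (at x)" by simp
      then have "(h has_real_derivative 0) (at x)"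
        by (rule has_field_derivative_transform_within_open[of _ _ _ "{..<0}"]) (use 2 in \<open>auto simp: h\<close>)
      then show ?thesis using 2 by simp
    next
      case 3
      \<comment> \<open>Replacing y by 1/y turns the difference quotient into a polynomial divided
        by exp at infinity; the factor \<open>[:0, 1:]\<close> is the division by the
        increment.\<close>
      have lim: "((\<lambda>y. poly p (1 / y) * exp (- 1 / y) / y) \<longlongrightarrow> 0) (at_right 0)"
      proof -
        have "((\<lambda>y. poly ([:0, 1:] * p) y / exp y) \<longlongrightarrow> 0) at_top"
          unfolding poly_altdef sum_divide_distrib
          by (intro tendsto_null_sum) (simp add: mult.assoc times_divide_eq_right[symmetric] tendsto_mult_right_zero tendsto_power_div_exp_0 del: times_divide_eq_right)
        then have "((\<lambda>y. poly ([:0, 1:] * p) (inverse y) / exp (inverse y)) \<longlongrightarrow> 0) (at_right 0)"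
          by (rule filterlim_compose[OF _ filterlim_inverse_at_top_right])
        then show ?thesis
          by (simp add: exp_minus field_simps inverse_eq_divide)
      qed
      have "((\<lambda>y. (h y - h 0) / (y - 0)) \<longlongrightarrow> 0) (at_right 0)"
        using lim by (rule filterlim_cong[THEN iffD1, rotated 3]) (auto simp: h eventually_at_right_less eventually_at_filter)
      moreover have "((\<lambda>y. (h y - h 0) / (y - 0)) \<longlongrightarrow> 0) (at_left 0)"
        by (rule tendsto_eventually) (auto simp: h eventually_at_filter)
      ultimately have "((\<lambda>y. (h y - h 0) / (y - 0)) \<longlongrightarrow> 0) (at 0)"
        by (simp add: filterlim_split_at)
      then show ?thesis using 3 by (simp add: has_field_derivative_iff)
    qed
  qed
  then show "\<exists>f'. (\<exists>p. f' = (\<lambda>x. if x > 0 then poly p (1 / x) * exp (- 1 / x) else 0)) \<and>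
      (\<forall>x. (h has_real_derivative f' x) (at x))"
    by blast
qed

text \<open>A product of two flat functions, one positive to the right of \<open>a\<close>, the
  other to the left of \<open>b\<close>.\<close>

lemma smooth_bump:
  fixes a b :: real
  assumes "a < b"
  obtains \<phi> where "smooth \<phi>" "\<And>x. \<phi> x \<ge> 0" "\<And>x. x \<notin> {a<..<b} \<Longrightarrow> \<phi> x = 0"
    "\<And>x. x \<in> {a<..<b} \<Longrightarrow> \<phi> x > 0"
proof -
  let ?f = "\<lambda>x::real. if x > 0 then exp (- 1 / x) else 0"
  have "smooth (\<lambda>x. ?f (1 * x + - a) * ?f (- 1 * x + b))"
    by (rule smooth_alg_imp_smooth[OF smooth_alg.mult[OF smooth_alg.affine[OF smooth_flat]
          smooth_alg.affine[OF smooth_flat]]])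
  then show thesis
    by (rule that) auto
qed

section \<open>Integration on the unit interval\<close>

lemma emeasure_unit_leb: "emeasure unit_leb (space unit_leb) = 1"
  by (simp add: emeasure_restrict_space)

lemma finite_measure_unit_leb: "finite_measure unit_leb"
  by (rule finite_measureI) (simp only: emeasure_unit_leb, simp)

lemma pair_sigma_finite_unit_leb: "pair_sigma_finite unit_leb unit_leb"
  using finite_measure_unit_leb by (simp add: pair_sigma_finite_def finite_measure_def)

text \<open>Passage from the Bochner integral over the open interval to the gauge integral over the
  closed one, for which the fundamental theorem of calculus is used.\<close>

lemma integrable_unit_leb_integral:
  fixes g :: "real \<Rightarrow> 'a::euclidean_space"
  assumes "integrable unit_leb g"
  shows "g integrable_on {0..1}" "integral\<^sup>L unit_leb g = integral {0..1} g"
  using integrable_on_lebesgue_on[OF assms] lebesgue_integral_eq_integral[OF assms]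
  by (auto simp: integrable_on_open_interval_real integral_open_interval_real)

lemma continuous_measurable_unit_leb:
  fixes f :: "real \<Rightarrow> 'a::euclidean_space"
  assumes "continuous_on {0..1} f"
  shows "f \<in> borel_measurable unit_leb"
  by (rule continuous_imp_measurable_on_sets_lebesgue)
    (auto intro: continuous_on_subset[OF assms])

lemma continuous_bounded_unit:
  fixes f :: "real \<Rightarrow> 'a::euclidean_space"
  assumes "continuous_on {0..1} f"
  obtains C where "C > 0" "\<And>x. x \<in> {0..1} \<Longrightarrow> norm (f x) \<le> C"
  using compact_imp_bounded[OF compact_continuous_image[OF assms compact_Icc]]
  unfolding bounded_pos by auto

lemma continuous_integrable_unit_leb:
  fixes f :: "real \<Rightarrow> 'a::euclidean_space"
  assumes "continuous_on {0..1} f"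
  shows "integrable unit_leb f"
proof -
  obtain C where "\<And>x. x \<in> {0..1} \<Longrightarrow> norm (f x) \<le> C"
    using continuous_bounded_unit[OF assms] by blast
  then show ?thesis
    by (intro finite_measure.integrable_const_bound[OF finite_measure_unit_leb, of f C]
        continuous_measurable_unit_leb[OF assms]) auto
qed

lemma sq_integrable_continuous:
  assumes "continuous_on {0..1} f"
  shows "sq_integrable f"
  unfolding sq_integrable_def
  using continuous_measurable_unit_leb[OF assms]
  by (auto intro!: continuous_integrable_unit_leb continuous_intros assms)

lemma sq_integrable_imp_integrable:
  assumes "sq_integrable f"
  shows "integrable unit_leb f"
proof -
  have i: "integrable unit_leb (\<lambda>x. 1 + (norm (f x))\<^sup>2)"
    using assms unfolding sq_integrable_def
    by (intro Bochner_Integration.integrable_add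
        finite_measure.integrable_const[OF finite_measure_unit_leb]) blast
  have "norm (f x) \<le> norm (1 + (norm (f x))\<^sup>2)" for x
    using zero_le_power2[of "norm (f x) - 1"] norm_ge_zero[of "f x"] unfolding power2_diff
    by (simp add: abs_if)
  then show ?thesis
    using sq_integrable_measurable[OF assms] by (intro Bochner_Integration.integrable_bound[OF i]) auto
qed

lemma integrable_unit_leb_indicator:
  fixes h :: "real \<Rightarrow> 'a::euclidean_space"
  assumes "integrable unit_leb h" "A \<in> sets borel"
  shows "integrable unit_leb (\<lambda>x. indicat_real A x *\<^sub>R h x)"
proof (rule Bochner_Integration.integrable_bound[OF assms(1)])
  have "(\<lambda>x. x) \<in> borel_measurable unit_leb"
    by (rule continuous_measurable_unit_leb) (rule continuous_on_id)
  then show "(\<lambda>x. indicat_real A x *\<^sub>R h x) \<in> borel_measurable unit_leb"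
    using assms by (intro borel_measurable_scaleR measurable_compose[OF _ borel_measurable_indicator])
      (auto intro: borel_measurable_integrable)
qed (auto simp: indicator_def)

lemma integral_product_indefinite:
  fixes p :: "'a::euclidean_space \<Rightarrow> 'b::euclidean_space \<Rightarrow> 'c::euclidean_space"
  assumes p: "bounded_bilinear p"
    and g: "integrable unit_leb g"
    and U: "\<And>x. x \<in> {0..1} \<Longrightarrow> (U has_vector_derivative U' x) (at x within {0..1})"
    and U': "continuous_on {0..1} U'"
  shows "(\<integral>t. p (g t) (U t) \<partial>unit_leb) =
    p (integral {0..1} g) (U 1) - (\<integral>x. p (integral {0..x} g) (U' x) \<partial>unit_leb)"
proof -
  let ?M = unit_leb
  interpret P: pair_sigma_finite ?M ?M by (rule pair_sigma_finite_unit_leb)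
  interpret F: finite_measure ?M by (rule finite_measure_unit_leb)
  interpret p: bounded_bilinear p by (rule p)
  \<comment> \<open>Integrating out \<open>x\<close> leaves \<open>U 1 - U t\<close>
    (\<open>inner1\<close>); integrating out \<open>t\<close> leaves the indefinite integral of
    \<open>g\<close> (\<open>inner2\<close>).\<close>
  define f where "f t x = indicat_real {t<..} x *\<^sub>R p (g t) (U' x)" for t x
  have Ucont: "continuous_on {0..1} U"
    using U by (meson continuous_on_eq_continuous_within has_vector_derivative_continuous)
  have gm[measurable]: "g \<in> borel_measurable ?M" using g by simp
  have Um[measurable]: "U' \<in> borel_measurable ?M" by (rule continuous_measurable_unit_leb[OF U'])
  have idm[measurable]: "(\<lambda>x. x) \<in> borel_measurable ?M"
    by (rule continuous_measurable_unit_leb) (rule continuous_on_id)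
  obtain C where C: "C > 0" "\<And>x. x \<in> {0..1} \<Longrightarrow> norm (U' x) \<le> C"
    using continuous_bounded_unit[OF U'] by blast
  obtain K where K: "K > 0" "\<And>a b. norm (p a b) \<le> norm a * norm b * K"
    using p.pos_bounded by blast
  have pc: "continuous_on UNIV (\<lambda>z. p (fst z) (snd z))"
    by (intro p.continuous_on continuous_on_fst continuous_on_snd continuous_on_id)
  have pm: "(\<lambda>z. p (g (fst z)) (U' (snd z))) \<in> borel_measurable (?M \<Otimes>\<^sub>M ?M)"
    by (rule borel_measurable_continuous_Pair[OF _ _ pc]) measurable
  have fm: "case_prod f \<in> borel_measurable (?M \<Otimes>\<^sub>M ?M)"
  proof -
    have [measurable]: "(\<lambda>z::real \<times> real. fst z) \<in> borel_measurable (?M \<Otimes>\<^sub>M ?M)"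
      "(\<lambda>z::real \<times> real. snd z) \<in> borel_measurable (?M \<Otimes>\<^sub>M ?M)"
      using measurable_compose[OF measurable_fst idm] measurable_compose[OF measurable_snd idm] by auto
    have "(\<lambda>z::real \<times> real. (if fst z < snd z then 1 else 0) *\<^sub>R p (g (fst z)) (U' (snd z))) \<in> borel_measurable (?M \<Otimes>\<^sub>M ?M)"
      using pm by measurable
    then show ?thesis
      by (rule measurable_cong[THEN iffD1, rotated]) (auto simp: f_def indicator_def)
  qed
  have gi: "integrable (?M \<Otimes>\<^sub>M ?M) (\<lambda>z. C * K * norm (g (fst z)))"
    by (rule P.Fubini_integrable) (use g in auto)
  have fi: "integrable (?M \<Otimes>\<^sub>M ?M) (case_prod f)"
  proof (rule Bochner_Integration.integrable_bound[OF gi fm])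
    show "AE z in ?M \<Otimes>\<^sub>M ?M. norm (case z of (t, x) \<Rightarrow> f t x) \<le> norm (C * K * norm (g (fst z)))"
    proof (rule AE_I2)
      fix z assume "z \<in> space (?M \<Otimes>\<^sub>M ?M)"
      then have z: "snd z \<in> {0..1}" by (auto simp: space_pair_measure)
      have "norm (p (g (fst z)) (U' (snd z))) \<le> norm (g (fst z)) * C * K"
        using K(2)[of "g (fst z)" "U' (snd z)"] C(2)[OF z] K(1)
        by (meson mult_left_mono mult_right_mono norm_ge_zero order_trans less_imp_le)
      then show "norm (case z of (t, x) \<Rightarrow> f t x) \<le> norm (C * K * norm (g (fst z)))"
        using C(1) K(1) by (auto simp: f_def case_prod_beta indicator_def abs_mult mult_ac)
    qed
  qed
  have inner1: "(\<integral>x. f t x \<partial>?M) = p (g t) (U 1) - p (g t) (U t)" if t: "t \<in> {0<..<1}" for t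
  proof -
    have "(U' has_integral (U 1 - U t)) {t..1}"
      using t by (intro fundamental_theorem_of_calculus)
        (auto intro: has_vector_derivative_within_subset[OF U])
    then have "(U' has_integral (U 1 - U t)) {t<..<1}"
      by (simp add: has_integral_Icc_iff_Ioo)
    then have "((\<lambda>x. p (g t) (U' x)) has_integral p (g t) (U 1 - U t)) {t<..<1}"
      by (rule has_integral_linear[OF _ p.bounded_linear_right, unfolded o_def])
    then have "((\<lambda>x. if x \<in> {t<..<1} then p (g t) (U' x) else 0) has_integral p (g t) (U 1 - U t)) {0<..<1}"
      using t by (subst has_integral_restrict) auto
    then have "(f t has_integral p (g t) (U 1 - U t)) {0<..<1}"
      by (rule has_integral_eq[rotated]) (auto simp: f_def indicator_def)
    moreover have "integrable ?M (f t)"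
    proof -
      have "integrable ?M (\<lambda>x. p (g t) (U' x))"
        by (intro integrable_bounded_linear[OF p.bounded_linear_right] continuous_integrable_unit_leb U')
      then show ?thesis
        unfolding f_def by (intro integrable_unit_leb_indicator) auto
    qed
    ultimately show ?thesis
      by (metis integrable_unit_leb_integral(2) integral_open_interval_real integral_unique p.diff_right)
  qed
  have inner2: "(\<integral>t. f t x \<partial>?M) = p (integral {0..x} g) (U' x)" if x: "x \<in> {0<..<1}" for x
  proof -
    have gx: "integrable ?M (\<lambda>t. indicat_real {..<x} t *\<^sub>R g t)"
      using g by (intro integrable_unit_leb_indicator) auto
    have "(\<integral>t. f t x \<partial>?M) = (\<integral>t. p (indicat_real {..<x} t *\<^sub>R g t) (U' x) \<partial>?M)"
      by (rule Bochner_Integration.integral_cong) (auto simp: f_def indicator_def p.zero_left)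
    also have "\<dots> = p (\<integral>t. indicat_real {..<x} t *\<^sub>R g t \<partial>?M) (U' x)"
      by (rule integral_bounded_linear[OF p.bounded_linear_left gx])
    also have "(\<integral>t. indicat_real {..<x} t *\<^sub>R g t \<partial>?M) = integral {0<..<1} (\<lambda>t. indicat_real {..<x} t *\<^sub>R g t)"
      using integrable_unit_leb_integral(2)[OF gx] by (simp add: integral_open_interval_real)
    also have "\<dots> = integral {0<..<1} (\<lambda>t. if t \<in> {0<..<x} then g t else 0)"
      by (rule integral_cong) (auto simp: indicator_def)
    also have "\<dots> = integral {0<..<x} g"
      using x by (subst integral_restrict_Int) (simp add: Int_absorb1)
    finally show ?thesis by (simp add: integral_open_interval_real)
  qed
  have iA: "integrable ?M (\<lambda>t. p (g t) (U 1))"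
    by (rule integrable_bounded_linear[OF p.bounded_linear_left g])
  have iB: "integrable ?M (\<lambda>t. p (g t) (U t))"
  proof -
    obtain D where D: "D > 0" "\<And>x. x \<in> {0..1} \<Longrightarrow> norm (U x) \<le> D"
      using continuous_bounded_unit[OF Ucont] by blast
    have [measurable]: "U \<in> borel_measurable ?M" by (rule continuous_measurable_unit_leb[OF Ucont])
    have "integrable ?M (\<lambda>t. D * K * norm (g t))" using g by simp
    moreover have "(\<lambda>t. p (g t) (U t)) \<in> borel_measurable ?M"
      by (rule borel_measurable_continuous_Pair[OF _ _ pc]) measurable
    moreover have "norm (p (g t) (U t)) \<le> norm (D * K * norm (g t))" if "t \<in> {0..1}" for t
    proof -
      have "norm (p (g t) (U t)) \<le> norm (g t) * D * K"
        using K(2)[of "g t" "U t"] D(2)[OF that] K(1)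
        by (meson mult_left_mono mult_right_mono norm_ge_zero order_trans less_imp_le)
      then show ?thesis using D(1) K(1) by (simp add: abs_mult mult_ac)
    qed
    ultimately show ?thesis
      by (elim Bochner_Integration.integrable_bound) auto
  qed
  have "(\<integral>x. p (integral {0..x} g) (U' x) \<partial>?M) = (\<integral>x. \<integral>t. f t x \<partial>?M \<partial>?M)"
    by (rule Bochner_Integration.integral_cong) (auto simp: inner2)
  also have "\<dots> = (\<integral>t. \<integral>x. f t x \<partial>?M \<partial>?M)"
    by (rule P.Fubini_integral[OF fi])
  also have "\<dots> = (\<integral>t. p (g t) (U 1) - p (g t) (U t) \<partial>?M)"
    by (rule Bochner_Integration.integral_cong) (auto simp: inner1)
  also have "\<dots> = p (integral {0..1} g) (U 1) - (\<integral>t. p (g t) (U t) \<partial>?M)"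
    using iA iB integral_bounded_linear[OF p.bounded_linear_left g]
    by (simp add: integrable_unit_leb_integral(2)[OF g])
  finally show ?thesis by simp
qed

text \<open>\<open>G\<close> differs from the indefinite integral of \<open>g\<close> by the
  constant \<open>G 0\<close>, whose contribution is evaluated by the fundamental theorem applied to
  \<open>U'\<close>.\<close>

lemma integration_by_parts_unit:
  fixes p :: "'a::euclidean_space \<Rightarrow> 'b::euclidean_space \<Rightarrow> 'c::euclidean_space"
  assumes p: "bounded_bilinear p"
    and g: "integrable unit_leb g"
    and G: "\<And>x. x \<in> {0..1} \<Longrightarrow> G x = G 0 + integral {0..x} g"
    and U: "\<And>x. x \<in> {0..1} \<Longrightarrow> (U has_vector_derivative U' x) (at x within {0..1})"
    and U': "continuous_on {0..1} U'"
  shows "(\<integral>t. p (g t) (U t) \<partial>unit_leb) =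
    p (G 1) (U 1) - p (G 0) (U 0) - (\<integral>x. p (G x) (U' x) \<partial>unit_leb)"
proof -
  interpret p: bounded_bilinear p by (rule p)
  have c: "continuous_on {0..1} (\<lambda>x. integral {0..x} g)"
    by (rule indefinite_integral_continuous_1) (rule integrable_unit_leb_integral(1)[OF g])
  have i: "integrable unit_leb (\<lambda>x. p (integral {0..x} g) (U' x))"
    "integrable unit_leb (\<lambda>x. p (G 0) (U' x))"
    by (intro continuous_integrable_unit_leb p.continuous_on continuous_intros c U')+
  have "(U' has_integral (U 1 - U 0)) {0..1}"
    by (intro fundamental_theorem_of_calculus U) auto
  then have "(\<integral>x. p (G 0) (U' x) \<partial>unit_leb) = p (G 0) (U 1 - U 0)"
    using integral_bounded_linear[OF p.bounded_linear_right[of "G 0"] continuous_integrable_unit_leb[OF U']]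
      integrable_unit_leb_integral(2)[OF continuous_integrable_unit_leb[OF U']]
    by (simp add: integral_unique)
  moreover have "(\<integral>x. p (G x) (U' x) \<partial>unit_leb) =
      (\<integral>x. p (G 0) (U' x) + p (integral {0..x} g) (U' x) \<partial>unit_leb)"
  proof (rule Bochner_Integration.integral_cong)
    fix x assume "x \<in> space unit_leb"
    then have "x \<in> {0..1}" by simp
    from G[OF this] show "p (G x) (U' x) = p (G 0) (U' x) + p (integral {0..x} g) (U' x)"
      by (metis p.add_left)
  qed simp
  ultimately show ?thesis
    using integral_product_indefinite[OF p g U U'] G[of 1] i
    by (simp add: p.diff_right p.add_left)
qed

section \<open>Linear differential equations\<close>

abbreviation has_deriv_unit :: "(real \<Rightarrow> 'a::real_normed_vector) \<Rightarrow> (real \<Rightarrow> 'a) \<Rightarrow> bool" where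
  "has_deriv_unit u u' \<equiv> \<forall>x\<in>{0..1}. (u has_vector_derivative u' x) (at x within {0..1})"

lemma has_deriv_unit_continuous:
  "has_deriv_unit u u' \<Longrightarrow> continuous_on {0..1} u"
  by (meson continuous_on_eq_continuous_within has_vector_derivative_continuous)

text \<open>Variation of constants.\<close>

lemma scalar_first_order_ode:
  fixes k :: "real \<Rightarrow> complex"
  assumes k: "continuous_on {0..1} k"
  shows "\<exists>w. w 0 = c \<and> has_deriv_unit w (\<lambda>x. \<kappa> * w x + k x)"
proof -
  define w where "w x = exp (of_real x * \<kappa>) * (c + integral {0..x} (\<lambda>t. exp (- of_real t * \<kappa>) * k t))" for x
  have E: "((\<lambda>x. exp (of_real x * \<kappa>)) has_vector_derivative exp (of_real x * \<kappa>) * \<kappa>) (at x within {0..1})" for x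
    by (auto intro!: derivative_eq_intros has_vector_derivative_real_field)
  have "(w has_vector_derivative \<kappa> * w x + k x) (at x within {0..1})" if x: "x \<in> {0..1}" for x
  proof -
    have "((\<lambda>x. integral {0..x} (\<lambda>t. exp (- of_real t * \<kappa>) * k t)) has_vector_derivative
        exp (- of_real x * \<kappa>) * k x) (at x within {0..1})"
      by (rule integral_has_vector_derivative) (use x in \<open>auto intro!: continuous_intros k\<close>)
    then have J: "((\<lambda>x. c + integral {0..x} (\<lambda>t. exp (- of_real t * \<kappa>) * k t)) has_vector_derivative
        exp (- of_real x * \<kappa>) * k x) (at x within {0..1})"
      by (auto intro!: derivative_eq_intros)
    show ?thesis
      unfolding w_def
      by (rule has_vector_derivative_eq_rhs[OF has_vector_derivative_mult[OF E J]])
        (simp add: algebra_simps exp_minus)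
  qed
  moreover have "w 0 = c" by (simp add: w_def)
  ultimately show ?thesis by blast
qed

text \<open>The operator factors as (d/dx + \<kappa>)(d/dx - \<kappa>) with \<kappa> a square root
  of \<mu>, so two first-order equations are solved in turn; \<open>v\<close> stands for
  \<open>u' - \<kappa> * u\<close>.\<close>

lemma scalar_second_order_ode:
  fixes k :: "real \<Rightarrow> complex"
  assumes k: "continuous_on {0..1} k"
  shows "\<exists>u u'. u 0 = c \<and> u' 0 = c' \<and> has_deriv_unit u u' \<and> has_deriv_unit u' (\<lambda>x. \<mu> * u x + k x)"
proof -
  define \<kappa> where "\<kappa> = csqrt \<mu>"
  have \<kappa>: "\<kappa> * \<kappa> = \<mu>" by (metis \<kappa>_def power2_csqrt power2_eq_square)
  obtain v where v: "v 0 = c' - \<kappa> * c" "has_deriv_unit v (\<lambda>x. - \<kappa> * v x + k x)"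
    using scalar_first_order_ode[OF k] by blast
  obtain u where u: "u 0 = c" "has_deriv_unit u (\<lambda>x. \<kappa> * u x + v x)"
    using scalar_first_order_ode[OF has_deriv_unit_continuous[OF v(2)]] by blast
  have "((\<lambda>x. \<kappa> * u x + v x) has_vector_derivative \<mu> * u x + k x) (at x within {0..1})"
    if x: "x \<in> {0..1}" for x
    by (rule has_vector_derivative_eq_rhs[OF has_vector_derivative_add[OF
          has_vector_derivative_mult_right[OF bspec[OF u(2) x]] bspec[OF v(2) x]]])
      (simp add: algebra_simps \<kappa>[symmetric])
  then show ?thesis
    using u v(1) by (intro exI[of _ u] exI[of _ "\<lambda>x. \<kappa> * u x + v x"]) simp
qed

text \<open>Triangularising the coefficient matrix leaves two scalar equations to be solved one
  after the other. One left eigenvector is enough, so non-diagonalisable matrices are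
  covered.\<close>

lemma planar_second_order_ode:
  fixes k1 k2 :: "real \<Rightarrow> complex"
  assumes k: "continuous_on {0..1} k1" "continuous_on {0..1} k2"
  shows "\<exists>u1 u1' u2 u2'. u1 0 = p1 \<and> u1' 0 = q1 \<and> u2 0 = p2 \<and> u2' 0 = q2 \<and>
    has_deriv_unit u1 u1' \<and> has_deriv_unit u1' (\<lambda>x. a * u1 x + b * u2 x + k1 x) \<and>
    has_deriv_unit u2 u2' \<and> has_deriv_unit u2' (\<lambda>x. c * u1 x + d * u2 x + k2 x)"
proof (cases "c = 0")
  case True
  obtain u2 u2' where u2: "u2 0 = p2" "u2' 0 = q2" "has_deriv_unit u2 u2'"
    "has_deriv_unit u2' (\<lambda>x. d * u2 x + k2 x)"
    using scalar_second_order_ode[OF k(2)] by blast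
  have "continuous_on {0..1} (\<lambda>x. b * u2 x + k1 x)"
    by (intro continuous_intros k has_deriv_unit_continuous[OF u2(3)])
  then obtain u1 u1' where "u1 0 = p1" "u1' 0 = q1" "has_deriv_unit u1 u1'"
    "has_deriv_unit u1' (\<lambda>x. a * u1 x + (b * u2 x + k1 x))"
    using scalar_second_order_ode by blast
  with u2 True show ?thesis
    by (intro exI[of _ u1] exI[of _ u1'] exI[of _ u2] exI[of _ u2']) (simp add: add.assoc)
next
  case False
  \<comment> \<open>An eigenvalue of the coefficient matrix, from the quadratic formula.\<close>
  define \<mu> where "\<mu> = ((a + d) + csqrt ((a - d)\<^sup>2 + 4 * b * c)) / 2"
  have "(csqrt ((a - d)\<^sup>2 + 4 * b * c))\<^sup>2 = (a - d)\<^sup>2 + 4 * b * c"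
    by (rule power2_csqrt)
  moreover have "csqrt ((a - d)\<^sup>2 + 4 * b * c) = 2 * \<mu> - (a + d)"
    by (simp add: \<mu>_def field_simps)
  ultimately have "(2 * \<mu> - (a + d))\<^sup>2 = (a - d)\<^sup>2 + 4 * b * c"
    by simp
  then have "4 * ((\<mu> - a) * (\<mu> - d)) = 4 * (b * c)"
    by algebra
  then have \<mu>: "(\<mu> - a) * (\<mu> - d) = b * c" by simp
  \<comment> \<open>The row vector \<open>(c, \<mu> - a)\<close> is a left eigenvector of the coefficient matrix, so
    \<open>s = c * u1 + (\<mu> - a) * u2\<close> satisfies a scalar equation.\<close>
  have ks: "continuous_on {0..1} (\<lambda>x. c * k1 x + (\<mu> - a) * k2 x)"
    by (intro continuous_on_add continuous_on_mult_left k)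
  obtain s s' where s: "s 0 = c * p1 + (\<mu> - a) * p2" "s' 0 = c * q1 + (\<mu> - a) * q2"
    "has_deriv_unit s s'" "has_deriv_unit s' (\<lambda>x. \<mu> * s x + (c * k1 x + (\<mu> - a) * k2 x))"
    using scalar_second_order_ode[OF ks] by blast
  have "continuous_on {0..1} (\<lambda>x. s x + k2 x)"
    by (intro continuous_on_add k has_deriv_unit_continuous[OF s(3)])
  \<comment> \<open>Replacing \<open>c * u1\<close> by \<open>s - (\<mu> - a) * u2\<close> in the
    second equation leaves the other eigenvalue, the trace minus \<open>\<mu>\<close>, as
    coefficient of \<open>u2\<close>.\<close>
  then obtain u2 u2' where u2: "u2 0 = p2" "u2' 0 = q2" "has_deriv_unit u2 u2'"
    "has_deriv_unit u2' (\<lambda>x. (a + d - \<mu>) * u2 x + (s x + k2 x))"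
    using scalar_second_order_ode by blast
  define u1 u1' where "u1 x = inverse c * (s x - (\<mu> - a) * u2 x)"
    and "u1' x = inverse c * (s' x - (\<mu> - a) * u2' x)" for x
  have su: "s x = c * u1 x + (\<mu> - a) * u2 x" for x
    using False by (simp add: u1_def mult.assoc[symmetric])
  have d1: "has_deriv_unit u1 u1'"
    unfolding u1_def u1'_def using s(3) u2(3)
    by (intro ballI has_vector_derivative_mult_right has_vector_derivative_diff) auto
  have e: "inverse c * (\<mu> * s x + (c * k1 x + (\<mu> - a) * k2 x) - (\<mu> - a) * ((a + d - \<mu>) * u2 x + (s x + k2 x)))
    = a * u1 x + b * u2 x + k1 x" (is "inverse c * ?l = ?r") for x
  proof -
    have "?l = c * (a * u1 x + k1 x) + ((\<mu> - a) * (\<mu> - d)) * u2 x"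
      unfolding su by (simp add: algebra_simps)
    also have "\<dots> = c * ?r"
      unfolding \<mu> by (simp add: algebra_simps)
    finally show ?thesis using False by simp
  qed
  have d2: "has_deriv_unit u1' (\<lambda>x. a * u1 x + b * u2 x + k1 x)"
    unfolding u1'_def[abs_def] e[symmetric] using s(4) u2(4)
    by (intro ballI has_vector_derivative_mult_right has_vector_derivative_diff) auto
  have e2: "(a + d - \<mu>) * u2 x + (s x + k2 x) = c * u1 x + d * u2 x + k2 x" for x
    unfolding su by (simp add: algebra_simps)
  show ?thesis
    using u2 d1 d2 s(1,2) False
    by (intro exI[of _ u1] exI[of _ u1'] exI[of _ u2] exI[of _ u2'])
      (simp add: e2 u1_def u1'_def)
qed

lemma has_vector_derivative_vec2:
  fixes u1 u2 :: "real \<Rightarrow> complex"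
  assumes "(u1 has_vector_derivative u1') F" "(u2 has_vector_derivative u2') F"
  shows "((\<lambda>x. vector [u1 x, u2 x] :: complex^2) has_vector_derivative vector [u1', u2']) F"
proof -
  have lin: "bounded_linear (\<lambda>c. axis i c :: complex^2)" for i
    by (intro linear_conv_bounded_linear[THEN iffD1] linearI)
      (auto simp: vec_eq_iff axis_def)
  have eq: "(vector [c1, c2] :: complex^2) = axis 1 c1 + axis 2 c2" for c1 c2
    by (simp add: vec_eq_iff forall_2 axis_def)
  show ?thesis
    unfolding eq
    by (intro has_vector_derivative_add bounded_linear.has_vector_derivative[OF lin] assms)
qed

lemma vector_second_order_ode:
  fixes M :: "complex^2^2" and k :: "real \<Rightarrow> complex^2"
  assumes k: "continuous_on {0..1} k"
  shows "\<exists>u u'. u 0 = p \<and> u' 0 = q \<and> has_deriv_unit u u' \<and> has_deriv_unit u' (\<lambda>x. M *v u x + k x)"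
proof -
  have "continuous_on {0..1} (\<lambda>x. k x $ 1)" "continuous_on {0..1} (\<lambda>x. k x $ 2)"
    by (intro continuous_intros k)+
  from planar_second_order_ode[OF this, of "p $ 1" "q $ 1" "p $ 2" "q $ 2" "M $ 1 $ 1" "M $ 1 $ 2" "M $ 2 $ 1" "M $ 2 $ 2"]
  obtain u1 u1' u2 u2' where u: "u1 0 = p $ 1" "u1' 0 = q $ 1" "u2 0 = p $ 2" "u2' 0 = q $ 2"
    and d: "has_deriv_unit u1 u1'" "has_deriv_unit u1' (\<lambda>x. M $ 1 $ 1 * u1 x + M $ 1 $ 2 * u2 x + k x $ 1)"
    "has_deriv_unit u2 u2'" "has_deriv_unit u2' (\<lambda>x. M $ 2 $ 1 * u1 x + M $ 2 $ 2 * u2 x + k x $ 2)"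
    by blast
  have e: "M *v vector [u1 x, u2 x] + k x = vector [M $ 1 $ 1 * u1 x + M $ 1 $ 2 * u2 x + k x $ 1,
      M $ 2 $ 1 * u1 x + M $ 2 $ 2 * u2 x + k x $ 2]" for x
    by (simp add: vec_eq_iff forall_2 matrix_vector_mult_def sum_2)
  show ?thesis
    by (rule exI[of _ "\<lambda>x. vector [u1 x, u2 x]"], rule exI[of _ "\<lambda>x. vector [u1' x, u2' x]"])
      (use u d in \<open>simp add: vec_eq_iff forall_2, simp add: e has_vector_derivative_vec2\<close>)
qed

section \<open>Weak derivatives\<close>

text \<open>\<open>g\<close> integrates to zero over initial intervals, hence by the pi-lambda
  theorem over all Borel sets; Lebesgue sets differ from Borel sets by null sets.\<close>

lemma AE_eq_0_if_indefinite_integral_0: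
  fixes g :: "real \<Rightarrow> 'a::euclidean_space"
  assumes g: "integrable unit_leb g" and 0: "\<And>x. x \<in> {0..1} \<Longrightarrow> integral {0..x} g = 0"
  shows "AE x in unit_leb. g x = 0"
proof -
  have ig: "g integrable_on {0..1}" by (rule integrable_unit_leb_integral(1)[OF g])
  have ind: "integrable unit_leb (\<lambda>x. indicat_real B x *\<^sub>R g x)" if "B \<in> sets borel" for B
    by (rule integrable_unit_leb_indicator[OF g that])
  have borel: "(\<integral>x. indicat_real B x *\<^sub>R g x \<partial>unit_leb) = 0" if "B \<in> sets borel" for B :: "real set"
  proof -
    have all: "integral\<^sup>L unit_leb g = 0"
      using 0[of 1] by (simp add: integrable_unit_leb_integral(2)[OF g])
    have "Int_stable (range (\<lambda>a::real. {..a}))" "range (\<lambda>a::real. {..a}) \<subseteq> Pow UNIV"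
      by (auto simp: Int_stable_def)
    moreover have "B \<in> sigma_sets UNIV (range (\<lambda>a. {..a}))"
      using that by (subst (asm) borel_eq_atMost) simp
    ultimately show ?thesis
    proof (induction rule: sigma_sets_induct_disjoint)
      case (basic A)
      then obtain a where A: "A = {..a}" by auto
      have "(\<integral>x. indicat_real A x *\<^sub>R g x \<partial>unit_leb) = integral {0..1} (\<lambda>x. indicat_real A x *\<^sub>R g x)"
        by (rule integrable_unit_leb_integral(2)[OF ind]) (simp add: A)
      also have "\<dots> = integral {0..1} (\<lambda>x. if x \<in> {0..min a 1} then g x else 0)"
        by (rule integral_cong) (auto simp: A indicator_def)
      also have "\<dots> = integral {0..min a 1} g"
        by (subst integral_restrict_Int) (auto intro!: arg_cong2[where f = integral])
      also have "\<dots> = 0"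
        by (cases "a < 0") (auto simp: min_def intro: 0)
      finally show ?case .
    next
      case empty
      then show ?case by simp
    next
      case (compl A)
      then have A: "A \<in> sets borel" by (subst borel_eq_atMost) simp
      have "(\<integral>x. indicat_real (UNIV - A) x *\<^sub>R g x \<partial>unit_leb)
          = (\<integral>x. g x - indicat_real A x *\<^sub>R g x \<partial>unit_leb)"
        by (rule Bochner_Integration.integral_cong) (auto simp: indicator_def)
      also have "\<dots> = 0"
        using compl.IH all g ind[OF A] by simp
      finally show ?case .
    next
      case (union A)
      have A: "A i \<in> sets borel" for i
        using union.hyps(2) by (subst borel_eq_atMost) auto
      \<comment> \<open>The pieces are cut down to the open interval to become measurable for
        \<open>unit_leb\<close>; the integrals do not see the cut.\<close>
      let ?A = "\<lambda>i. A i \<inter> {0<..<1}"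
      have eq: "(LINT x : B \<inter> {0<..<1} | unit_leb. g x) = (\<integral>x. indicat_real B x *\<^sub>R g x \<partial>unit_leb)" for B
        unfolding set_lebesgue_integral_def
        by (rule Bochner_Integration.integral_cong) (auto simp: indicator_def)
      have "(LINT x:(\<Union>i. ?A i) | unit_leb. g x) = (\<Sum>i. (LINT x:(?A i) | unit_leb. g x))"
      proof (rule lebesgue_integral_countable_add)
        show "?A i \<in> sets unit_leb" for i
          using A[of i] by (auto simp: sets_restrict_space)
        show "i \<noteq> j \<Longrightarrow> ?A i \<inter> ?A j = {}" for i j
          using union.hyps(1) by (auto simp: disjoint_family_on_def)
        have "integrable unit_leb (\<lambda>x. indicat_real (\<Union>i. ?A i) x *\<^sub>R g x)"
          by (rule ind) (use A in auto)
        then show "set_integrable unit_leb (\<Union>i. ?A i) g"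
          by (simp add: set_integrable_def)
      qed
      also have "\<dots> = 0" using union.IH by (simp add: eq)
      also have "(\<Union>i. ?A i) = (\<Union>i. A i) \<inter> {0<..<1}" by blast
      finally show ?case by (simp add: eq)
    qed
  qed
  interpret finite_measure unit_leb by (rule finite_measure_unit_leb)
  show ?thesis
  proof (rule density_zero[OF g])
    fix A assume "A \<in> sets unit_leb"
    then obtain B where B: "B \<in> sets lebesgue" "A = B \<inter> {0<..<1}"
      by (auto simp: sets_restrict_space)
    from sets_completionE[OF B(1)] obtain S N N' where
      S: "B = S \<union> N" "N \<subseteq> N'" "N' \<in> null_sets lborel" "S \<in> sets lborel" by metis
    have "AE x in lebesgue. x \<notin> N'"
      using S(3) by (intro AE_not_in) (auto intro: null_sets_completionI)
    then have "AE x in unit_leb. x \<notin> N'"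
      by (simp add: AE_restrict_space_iff) (auto elim: AE_mp)
    then have ae: "AE x in unit_leb. indicat_real A x *\<^sub>R g x = indicat_real S x *\<^sub>R g x"
      by (rule AE_mp) (use S B in \<open>auto simp: indicator_def intro!: AE_I2\<close>)
    have "set_lebesgue_integral unit_leb A g = (\<integral>x. indicat_real S x *\<^sub>R g x \<partial>unit_leb)"
      unfolding set_lebesgue_integral_def
      by (rule integral_cong_AE[OF _ _ ae])
        (use ind[of S] S(4) g \<open>A \<in> sets unit_leb\<close> in \<open>auto intro!: borel_measurable_scaleR borel_measurable_indicator\<close>)
    then show "set_lebesgue_integral unit_leb A g = 0"
      using borel S(4) by simp
  qed
qed

section \<open>Test functions and the du Bois-Reymond lemma\<close>

lemma test_function_iff:
  "test_function u \<longleftrightarrow> smooth u \<and> (\<exists>a b. 0 < a \<and> b < 1 \<and> (\<forall>x. x \<notin> {a..b} \<longrightarrow> u x = 0))"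
  by (simp add: test_function_def)

lemma deriv_0_outside:
  assumes "\<And>x. x \<notin> {a..b} \<Longrightarrow> u x = (0::real)" and x: "x \<notin> {a..b}"
  shows "deriv u x = 0"
proof -
  have "((\<lambda>x. 0) has_real_derivative 0) (at x)" by simp
  then have "(u has_real_derivative 0) (at x)"
    by (rule has_field_derivative_transform_within_open[of _ _ _ "- {a..b}"])
      (use assms in \<open>auto simp: open_Compl\<close>)
  then show ?thesis by (rule DERIV_imp_deriv)
qed

lemma test_function_facts:
  assumes "test_function u"
  shows "has_deriv_unit u (deriv u)" "has_deriv_unit (deriv u) (deriv (deriv u))"
    "continuous_on {0..1} u" "continuous_on {0..1} (deriv u)" "continuous_on {0..1} (deriv (deriv u))"
    "u 0 = 0" "u 1 = 0" "deriv u 0 = 0" "deriv u 1 = 0"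
proof -
  have s: "smooth u" and s1: "smooth (deriv u)" and s2: "smooth (deriv (deriv u))"
    using assms smooth_has_deriv(2) by (auto simp: test_function_iff)
  show "has_deriv_unit u (deriv u)" "has_deriv_unit (deriv u) (deriv (deriv u))"
    using smooth_has_deriv(1)[OF s] smooth_has_deriv(1)[OF s1]
    by (auto intro: has_vector_derivative_at_within simp: has_real_derivative_iff_has_vector_derivative)
  show "continuous_on {0..1} u" "continuous_on {0..1} (deriv u)" "continuous_on {0..1} (deriv (deriv u))"
    using smooth_continuous s s1 s2 by blast+
  obtain a b where "0 < a" "b < 1" "\<And>x. x \<notin> {a..b} \<Longrightarrow> u x = 0"
    using assms by (auto simp: test_function_iff)
  then show "u 0 = 0" "u 1 = 0" "deriv u 0 = 0" "deriv u 1 = 0"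
    using deriv_0_outside[of a b u] by auto
qed

text \<open>Mean zero makes the antiderivative that starts with 0 at 0 vanish again at 1. It is
  constant on either side of \<open>{a..b}\<close>, hence zero there.\<close>

lemma test_function_antiderivative:
  assumes \<rho>: "smooth \<rho>" "0 < a" "b < 1" "\<And>x. x \<notin> {a..b} \<Longrightarrow> \<rho> x = 0"
    and int0: "integral {0..1} \<rho> = 0"
  obtains u where "test_function u" "deriv u = \<rho>"
proof -
  have "\<exists>F. \<forall>x :: real. - \<infinity> < ereal x \<longrightarrow> ereal x < \<infinity> \<longrightarrow> (F has_vector_derivative \<rho> x) (at x)"
    using smooth_continuous[OF \<rho>(1), of UNIV]
    by (intro einterval_antiderivative) (auto simp: continuous_on_eq_continuous_at)
  then obtain F where F: "\<And>x. (F has_vector_derivative \<rho> x) (at x)"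
    by auto
  define u where "u x = F x - F 0" for x
  have u: "(u has_real_derivative \<rho> x) (at x)" for x
    using F[of x] unfolding u_def has_real_derivative_iff_has_vector_derivative
    by (auto intro!: derivative_eq_intros)
  have du: "deriv u = \<rho>" using u by (simp add: DERIV_imp_deriv fun_eq_iff)
  have "(\<rho> has_integral u 1 - u 0) {0..1}"
    using u by (intro fundamental_theorem_of_calculus)
      (auto intro: has_vector_derivative_at_within simp: has_real_derivative_iff_has_vector_derivative)
  then have u01: "u 0 = 0" "u 1 = 0" using int0 by (simp_all add: u_def integral_unique)
  have "u x = 0" if "x \<in> {..<a}" for x
  proof -
    have "\<exists>c. \<forall>x\<in>{..<a}. u x = c"
      by (rule has_field_derivative_zero_constant)
        (use u \<rho>(4) in \<open>auto intro: has_field_derivative_at_within, metis atLeastAtMost_iff has_field_derivative_at_within leD\<close>)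
    then show ?thesis using that u01(1) \<rho>(2) by fastforce
  qed
  moreover have "u x = 0" if "x \<in> {b<..}" for x
  proof -
    have "\<exists>c. \<forall>x\<in>{b<..}. u x = c"
      by (rule has_field_derivative_zero_constant)
        (use u \<rho>(4) in \<open>auto intro: has_field_derivative_at_within, metis atLeastAtMost_iff has_field_derivative_at_within leD\<close>)
    then show ?thesis using that u01(2) \<rho>(3) by fastforce
  qed
  ultimately have "\<And>x. x \<notin> {a..b} \<Longrightarrow> u x = 0"
    by (metis atLeastAtMost_iff greaterThan_iff lessThan_iff not_le)
  moreover have "smooth u"
    unfolding smooth_iff_deriv[of u] du using \<rho>(1) u field_differentiable_def by blast
  ultimately show thesis
    using that du \<rho>(2,3) test_function_iff by blast
qed

text \<open>Subtracting a multiple of a fixed bump \<open>\<eta>\<close> turns any smooth function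
  supported inside the interval into one of mean zero, hence into the derivative of a test function.
  So \<open>K - c\<close> is orthogonal to all such functions for one constant \<open>c\<close>, and
  a bump near a point where \<open>K\<close> differs from \<open>c\<close> contradicts this.\<close>

lemma du_Bois_Reymond:
  fixes K :: "real \<Rightarrow> 'a::euclidean_space"
  assumes K: "continuous_on {0..1} K"
    and 0: "\<And>u. test_function u \<Longrightarrow> (\<integral>x. deriv u x *\<^sub>R K x \<partial>unit_leb) = 0"
    and x: "x \<in> {0..1}"
  shows "K x = K 0"
proof -
  obtain \<eta> where \<eta>: "smooth \<eta>" "\<And>x. \<eta> x \<ge> 0" "\<And>x::real. x \<notin> {1/3<..<2/3} \<Longrightarrow> \<eta> x = 0"
    "\<And>x. x \<in> {1/3<..<2/3} \<Longrightarrow> \<eta> x > 0"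
    by (rule smooth_bump[of "1/3" "2/3"]) auto
  define m where "m = integral {0..1} \<eta>"
  have "m \<noteq> 0"
  proof
    assume "m = 0"
    then have "\<forall>x\<in>{0..1}. \<eta> x = 0"
      unfolding m_def using \<eta>(2) smooth_continuous[OF \<eta>(1)] by (subst (asm) integral_eq_0_iff) auto
    then show False using \<eta>(4)[of "1/2"] by auto
  qed
  \<comment> \<open>The mean of \<open>K\<close> weighted by \<open>\<eta>\<close>; this value is
    forced by orthogonality of \<open>K - c\<close> to \<open>\<eta>\<close> itself.\<close>
  define c where "c = (1 / m) *\<^sub>R (\<integral>x. \<eta> x *\<^sub>R K x \<partial>unit_leb)"
  have int: "integrable unit_leb (\<lambda>x. \<psi> x *\<^sub>R K x)" "integrable unit_leb \<psi>" if "smooth \<psi>" for \<psi>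
    using smooth_continuous[OF that] by (auto intro!: continuous_integrable_unit_leb continuous_on_scaleR K)
  have key: "(\<integral>x. \<psi> x *\<^sub>R (K x - c) \<partial>unit_leb) = 0"
    if \<psi>: "smooth \<psi>" "0 < a" "b < 1" "\<And>x. x \<notin> {a..b} \<Longrightarrow> \<psi> x = 0" for \<psi> a b
  proof -
    define n where "n = integral {0..1} \<psi> / m"
    let ?\<rho> = "\<lambda>x. \<psi> x - n * \<eta> x"
    have "smooth ?\<rho>" by (rule smooth_diff_scale[OF \<psi>(1) \<eta>(1)])
    moreover have "integral {0..1} ?\<rho> = integral {0..1} \<psi> - n * m"
      using smooth_continuous[OF \<psi>(1)] smooth_continuous[OF \<eta>(1)] unfolding m_def
      by (subst integral_diff) (auto intro!: integrable_continuous_interval continuous_intros)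
    then have "integral {0..1} ?\<rho> = 0" using \<open>m \<noteq> 0\<close> by (simp add: n_def)
    moreover have "?\<rho> x = 0" if "x \<notin> {min a (1/3)..max b (2/3)}" for x
      using \<psi>(4)[of x] \<eta>(3)[of x] that by (auto simp: min_def max_def split: if_splits)
    moreover have "0 < min a (1/3)" "max b (2/3) < 1" using \<psi> by auto
    ultimately obtain u where "test_function u" "deriv u = ?\<rho>"
      using test_function_antiderivative[of ?\<rho> "min a (1/3)" "max b (2/3)"] by blast
    then have "0 = (\<integral>x. ?\<rho> x *\<^sub>R K x \<partial>unit_leb)"
      using 0 by metis
    also have "\<dots> = (\<integral>x. \<psi> x *\<^sub>R K x - n *\<^sub>R (\<eta> x *\<^sub>R K x) \<partial>unit_leb)"
      by (simp add: algebra_simps)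
    also have "\<dots> = (\<integral>x. \<psi> x *\<^sub>R K x \<partial>unit_leb) - n *\<^sub>R (\<integral>x. \<eta> x *\<^sub>R K x \<partial>unit_leb)"
      using int[OF \<psi>(1)] int[OF \<eta>(1)]
      by (subst Bochner_Integration.integral_diff) (auto simp del: scaleR_scaleR)
    also have "(\<integral>x. \<eta> x *\<^sub>R K x \<partial>unit_leb) = m *\<^sub>R c"
      using \<open>m \<noteq> 0\<close> by (simp add: c_def)
    also have "n *\<^sub>R m *\<^sub>R c = (n * m) *\<^sub>R c" by simp
    also have "n * m = (\<integral>x. \<psi> x \<partial>unit_leb)"
      using \<open>m \<noteq> 0\<close> int[OF \<psi>(1)] by (simp add: n_def integrable_unit_leb_integral(2))
    finally show ?thesis
      using int[OF \<psi>(1)] by (simp add: scaleR_diff_right)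
  qed
  have eq: "K y = c" if y: "y \<in> {0<..<1}" for y
  proof (rule ccontr)
    assume ne: "K y \<noteq> c"
    \<comment> \<open>Projecting on \<open>K y - c\<close> makes the argument scalar:
      \<open>w\<close> is the squared norm at \<open>y\<close>, hence positive nearby.\<close>
    define w where "w z = (K z - c) \<bullet> (K y - c)" for z
    have wy: "w y > 0" using ne by (simp add: w_def)
    have wc: "continuous_on {0..1} w" unfolding w_def by (intro continuous_intros K)
    then obtain d where d: "d > 0" "\<And>z. z \<in> {0..1} \<Longrightarrow> dist z y < d \<Longrightarrow> dist (w z) (w y) < w y"
      using wy y unfolding continuous_on_iff by (metis atLeastAtMost_iff greaterThanLessThan_iff less_imp_le)
    \<comment> \<open>The radius keeps \<open>w\<close> positive on the bump and the bump inside the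
      open interval; the halves make all inequalities strict.\<close>
    define e where "e = min (d / 2) (min (y / 2) ((1 - y) / 2))"
    have "e > 0"
      using d(1) y by (simp add: e_def)
    moreover have "e \<le> d / 2" "e \<le> y / 2" "e \<le> (1 - y) / 2"
      unfolding e_def by (meson min.cobounded1 min.cobounded2 order_trans)+
    ultimately have e: "e > 0" "e < d" "y - e > 0" "y + e < 1" using d(1) y by auto
    obtain \<psi> where \<psi>: "smooth \<psi>" "\<And>x. \<psi> x \<ge> 0" "\<And>x. x \<notin> {y - e<..<y + e} \<Longrightarrow> \<psi> x = 0"
      "\<And>x. x \<in> {y - e<..<y + e} \<Longrightarrow> \<psi> x > 0"
      using e by (elim smooth_bump[of "y - e" "y + e", rotated]) auto
    have pos: "\<psi> z * w z \<ge> 0" if "z \<in> {0..1}" for z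
    proof (cases "z \<in> {y - e<..<y + e}")
      case True
      then have "dist z y < d" using e by (auto simp: dist_real_def)
      then have "w z > 0" using d(2)[OF that] by (auto simp: dist_real_def)
      then show ?thesis using \<psi>(2)[of z] by simp
    qed (simp add: \<psi>(3))
    have c': "continuous_on {0..1} (\<lambda>z. \<psi> z * w z)"
      using smooth_continuous[OF \<psi>(1)] wc by (intro continuous_intros)
    have "(\<integral>z. \<psi> z * w z \<partial>unit_leb) = (\<integral>z. (\<psi> z *\<^sub>R (K z - c)) \<bullet> (K y - c) \<partial>unit_leb)"
      by (simp add: w_def)
    also have "\<dots> = (\<integral>z. \<psi> z *\<^sub>R (K z - c) \<partial>unit_leb) \<bullet> (K y - c)"
      using smooth_continuous[OF \<psi>(1)]
      by (intro integral_inner_left continuous_integrable_unit_leb continuous_intros K)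
    also have "\<dots> = 0"
    proof -
      have "\<psi> z = 0" if "z \<notin> {y - e..y + e}" for z
        using \<psi>(3)[of z] that by auto
      from key[OF \<psi>(1) e(3,4) this] show ?thesis by simp
    qed
    finally have "integral {0..1} (\<lambda>z. \<psi> z * w z) = 0"
      using integrable_unit_leb_integral(2)[OF continuous_integrable_unit_leb[OF c']] by simp
    then have "\<psi> y * w y = 0"
      using pos c' y by (subst (asm) integral_eq_0_iff) auto
    then show False using \<psi>(4)[of y] wy e by simp
  qed
  have "K z = c" if "z \<in> {0..1}" for z
    using continuous_constant_on_closure[of "{0<..<1}" K c z] eq K that by simp
  then show ?thesis using x by simp
qed

section \<open>Integration by parts against test functions\<close>

lemma bounded_bilinear_scaleR_flip:
  "bounded_bilinear (\<lambda>(a :: 'a::real_normed_vector) b. b *\<^sub>R a)"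
  by (rule bounded_bilinear.flip[OF bounded_bilinear_scaleR])

lemma weak_integral_second_deriv:
  fixes F F' :: "real \<Rightarrow> 'a::euclidean_space"
  assumes u: "test_function u" and F: "has_deriv_unit F F'" and F': "continuous_on {0..1} F'"
  shows "(\<integral>x. deriv (deriv u) x *\<^sub>R F x \<partial>unit_leb) = - (\<integral>x. deriv u x *\<^sub>R F' x \<partial>unit_leb)"
proof -
  note t = test_function_facts[OF u]
  have "F x = F 0 + integral {0..x} F'" if "x \<in> {0..1}" for x
  proof -
    have "(F' has_integral F x - F 0) {0..x}"
      using that by (intro fundamental_theorem_of_calculus
          has_vector_derivative_within_subset[OF bspec[OF F]]) auto
    then show ?thesis by (simp add: integral_unique)
  qed
  from integration_by_parts_unit[OF bounded_bilinear_scaleR_flip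
      continuous_integrable_unit_leb[OF F'] this bspec[OF t(2)] t(5)]
  show ?thesis using t by simp
qed

lemma weak_integral_first_deriv:
  fixes g :: "real \<Rightarrow> 'a::euclidean_space"
  assumes u: "test_function u" and g: "integrable unit_leb g"
    and G: "\<And>x. x \<in> {0..1} \<Longrightarrow> G x = G 0 + integral {0..x} g"
  shows "(\<integral>x. u x *\<^sub>R g x \<partial>unit_leb) = - (\<integral>x. deriv u x *\<^sub>R G x \<partial>unit_leb)"
proof -
  note t = test_function_facts[OF u]
  from integration_by_parts_unit[OF bounded_bilinear_scaleR_flip g G bspec[OF t(1)] t(4)]
  show ?thesis using t by simp
qed

text \<open>The second fact, trivial because the integral over \<open>{0..0}\<close> is 0, has the
  shape of the hypothesis \<open>G\<close> of \<open>weak_integral_first_deriv\<close>.\<close>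

lemma indefinite_integral_facts:
  fixes g :: "real \<Rightarrow> 'a::euclidean_space"
  assumes g: "integrable unit_leb g"
  shows "continuous_on {0..1} (\<lambda>x. integral {0..x} g)"
    "\<And>x. integral {0..x} g = integral {0..0} g + integral {0..x} g"
  using indefinite_integral_continuous_1[OF integrable_unit_leb_integral(1)[OF g]] by auto

text \<open>Integration by parts moves the question to the indefinite integral of \<open>g\<close>.
  It is continuous, so the du Bois-Reymond lemma makes it constant, with value 0 at 0.\<close>

lemma AE_eq_0_if_weakly_0:
  fixes g :: "real \<Rightarrow> 'a::euclidean_space"
  assumes g: "integrable unit_leb g"
    and 0: "\<And>u. test_function u \<Longrightarrow> (\<integral>x. u x *\<^sub>R g x \<partial>unit_leb) = 0"
  shows "AE x in unit_leb. g x = 0"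
proof (rule AE_eq_0_if_indefinite_integral_0[OF g])
  fix x :: real assume "x \<in> {0..1}"
  have "integral {0..x} g = integral {0..0} g"
    by (rule du_Bois_Reymond[OF indefinite_integral_facts(1)[OF g] _ \<open>x \<in> {0..1}\<close>])
      (use weak_integral_first_deriv[OF _ g indefinite_integral_facts(2)[OF g]] 0 in simp)
  then show "integral {0..x} g = 0" by simp
qed

text \<open>This trades the distributional second derivative for an integral equation for
  \<open>F'\<close>, the form that integration by parts and the ODE can use. From left to right,
  \<open>F'\<close> minus the indefinite integral of \<open>g\<close> is orthogonal to all
  derivatives of test functions.\<close>

lemma weak_second_deriv_iff:
  fixes F F' g :: "real \<Rightarrow> 'a::euclidean_space"
  assumes F: "has_deriv_unit F F'" and F': "continuous_on {0..1} F'" and g: "integrable unit_leb g"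
  shows "(\<forall>u. test_function u \<longrightarrow>
      (\<integral>x. deriv (deriv u) x *\<^sub>R F x \<partial>unit_leb) = (\<integral>x. u x *\<^sub>R g x \<partial>unit_leb)) \<longleftrightarrow>
    (\<forall>x\<in>{0..1}. F' x = F' 0 + integral {0..x} g)" (is "?L \<longleftrightarrow> ?R")
proof
  assume ?R
  then have G: "F' x = F' 0 + integral {0..x} g" if "x \<in> {0..1}" for x
    using that by blast
  show ?L
    using weak_integral_second_deriv[OF _ F F'] weak_integral_first_deriv[OF _ g G] by simp
next
  assume ?L
  define K where "K x = F' x - integral {0..x} g" for x
  have K: "K x = K 0" if "x \<in> {0..1}" for x
  proof (rule du_Bois_Reymond[OF _ _ that])
    show "continuous_on {0..1} K"
      unfolding K_def by (intro continuous_intros F' indefinite_integral_facts(1)[OF g])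
    fix u assume u: "test_function u"
    have i: "integrable unit_leb (\<lambda>x. deriv u x *\<^sub>R F' x)"
      "integrable unit_leb (\<lambda>x. deriv u x *\<^sub>R integral {0..x} g)"
      by (intro continuous_integrable_unit_leb continuous_on_scaleR F' indefinite_integral_facts(1)[OF g]
          test_function_facts(4)[OF u])+
    then show "(\<integral>x. deriv u x *\<^sub>R K x \<partial>unit_leb) = 0"
      using \<open>?L\<close> u weak_integral_second_deriv[OF u F F']
        weak_integral_first_deriv[OF u g indefinite_integral_facts(2)[OF g]]
      by (simp add: K_def scaleR_diff_right)
  qed
  show ?R
  proof
    fix x :: real assume "x \<in> {0..1}"
    from K[OF this] have "F' x - integral {0..x} g = F' 0" by (simp add: K_def)
    then show "F' x = F' 0 + integral {0..x} g" by (rule diff_eq_eq[THEN iffD1])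
  qed
qed

section \<open>The space of square integrable functions and the domain of the operator\<close>

lemma L2_eq_refl: "sq_integrable F \<Longrightarrow> L2_eq F F"
  by (simp add: L2_eq_def)

text \<open>Equality almost everywhere becomes equality of classes, so that lifted operations can be
  computed on representatives. Square integrability stays as a conjunct because the quotient is
  partial.\<close>

lemma represented_by_iff: "represented_by f F \<longleftrightarrow> sq_integrable F \<and> f = abs_L2 F"
proof -
  have r: "L2_eq (rep_L2 f) (rep_L2 f)" "abs_L2 (rep_L2 f) = f"
    using Quotient_rep_reflp[OF Quotient_L2] Quotient_abs_rep[OF Quotient_L2] by auto
  have "represented_by (abs_L2 (rep_L2 f)) F \<longleftrightarrow> sq_integrable F \<and> (AE x in unit_leb. rep_L2 f x = F x)"
    unfolding represented_by.abs_eq[OF r(1)] ..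
  also have "\<dots> \<longleftrightarrow> sq_integrable F \<and> L2_eq (rep_L2 f) F"
    using r(1) by (auto simp: L2_eq_def)
  also have "\<dots> \<longleftrightarrow> sq_integrable F \<and> abs_L2 (rep_L2 f) = abs_L2 F"
    using Quotient_rel[OF Quotient_L2, of "rep_L2 f" F] r(1) L2_eq_refl[of F] by auto
  finally show ?thesis by (simp add: r(2))
qed

lemma represented_by_ex: obtains F where "represented_by f F"
proof -
  have "L2_eq (rep_L2 f) (rep_L2 f)" "abs_L2 (rep_L2 f) = f"
    using Quotient_rep_reflp[OF Quotient_L2] Quotient_abs_rep[OF Quotient_L2] by auto
  then show thesis using that[of "rep_L2 f"] by (simp add: represented_by_iff L2_eq_def)
qed

lemma represented_by_sq_integrable: "represented_by f F \<Longrightarrow> sq_integrable F"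
  by (simp add: represented_by_iff)

lemma represented_by_integrable: "represented_by f F \<Longrightarrow> integrable unit_leb F"
  by (simp add: represented_by_iff sq_integrable_imp_integrable)

lemma represented_by_abs: "sq_integrable F \<Longrightarrow> represented_by (abs_L2 F) F"
  by (simp add: represented_by_iff)

lemma represented_by_eqI:
  assumes "represented_by f F" "represented_by g G" "AE x in unit_leb. F x = G x"
  shows "f = g"
  using assms Quotient_rel[OF Quotient_L2, of F G] by (auto simp: represented_by_iff L2_eq_def)

lemma represented_by_add:
  assumes "represented_by f F" "represented_by g G"
  shows "represented_by (f + g) (\<lambda>x. F x + G x)"
  using assms by (auto simp: represented_by_iff plus_L2.abs_eq L2_eq_refl intro: sq_integrable_add)

lemma represented_by_diff:
  assumes "represented_by f F" "represented_by g G"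
  shows "represented_by (f - g) (\<lambda>x. F x - G x)"
  using assms by (auto simp: represented_by_iff minus_L2.abs_eq L2_eq_refl intro: sq_integrable_diff)

lemma represented_by_minus:
  assumes "represented_by f F"
  shows "represented_by (- f) (\<lambda>x. - F x)"
  using assms by (auto simp: represented_by_iff uminus_L2.abs_eq L2_eq_refl intro: sq_integrable_minus)

lemma represented_by_scaleR:
  assumes "represented_by f F"
  shows "represented_by (c *\<^sub>R f) (\<lambda>x. c *\<^sub>R F x)"
  using assms by (auto simp: represented_by_iff scaleR_L2.abs_eq L2_eq_refl intro: sq_integrable_scaleR)

lemma represented_by_scaleC:
  assumes "represented_by f F"
  shows "represented_by (scaleC_L2 c f) (\<lambda>x. c *s F x)"
  using assms by (auto simp: represented_by_iff scaleC_L2.abs_eq L2_eq_refl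
      intro: sq_integrable_bounded_linear bounded_linear_scale_vec)

lemma represented_by_matrix:
  assumes "represented_by f F"
  shows "represented_by (matrix_L2 A f) (\<lambda>x. A *v F x)"
  using assms by (auto simp: represented_by_iff matrix_L2.abs_eq L2_eq_refl
      intro: sq_integrable_bounded_linear bounded_linear_matrix_vec)

lemmas represented_by_intros = represented_by_add represented_by_diff represented_by_minus
  represented_by_scaleR represented_by_scaleC represented_by_matrix

lemma inner_represented_by:
  assumes "represented_by f F" "represented_by g G"
  shows "f \<bullet> g = (\<integral>x. F x \<bullet> G x \<partial>unit_leb)"
  using assms by (simp add: represented_by_iff inner_L2.abs_eq L2_eq_refl)

lemma norm_represented_by:
  assumes "represented_by f F"
  shows "(norm f)\<^sup>2 = (\<integral>x. (norm (F x))\<^sup>2 \<partial>unit_leb)"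
  using inner_represented_by[OF assms assms] by (simp add: power2_norm_eq_inner)

section \<open>The weak second derivative and the domain\<close>

lemma has_weak_deriv_2_represented_by:
  assumes "represented_by f F" "represented_by g G"
  shows "has_weak_deriv 2 f g \<longleftrightarrow> (\<forall>u. test_function u \<longrightarrow>
      (\<integral>x. deriv (deriv u) x *\<^sub>R F x \<partial>unit_leb) = (\<integral>x. u x *\<^sub>R G x \<partial>unit_leb))"
  using assms by (simp add: represented_by_iff has_weak_deriv.abs_eq L2_eq_refl eval_nat_numeral)

text \<open>The difference of two candidates is weakly zero. This makes the definite description in
  \<open>weak_deriv2\<close> denote.\<close>

lemma has_weak_deriv_2_unique:
  assumes "has_weak_deriv 2 f g" "has_weak_deriv 2 f h"
  shows "g = h"
proof -
  obtain F G H where rep: "represented_by f F" "represented_by g G" "represented_by h H"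
    using represented_by_ex by metis
  note int = rep(2,3)[THEN represented_by_integrable]
  have "AE x in unit_leb. G x - H x = 0"
  proof (rule AE_eq_0_if_weakly_0)
    show "integrable unit_leb (\<lambda>x. G x - H x)" using int by simp
    fix u assume u: "test_function u"
    have "integrable unit_leb (\<lambda>x. u x *\<^sub>R K x)" if K: "integrable unit_leb K" for K :: "real \<Rightarrow> complex^2"
    proof -
      obtain C where C: "C > 0" "\<And>x. x \<in> {0..1} \<Longrightarrow> norm (u x) \<le> C"
        using continuous_bounded_unit[OF test_function_facts(3)[OF u]] by blast
      have "integrable unit_leb (\<lambda>x. C *\<^sub>R K x)" using K by simp
      then show ?thesis
        using C K continuous_measurable_unit_leb[OF test_function_facts(3)[OF u]]
        by (elim Bochner_Integration.integrable_bound)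
          (auto intro!: AE_I2 mult_right_mono borel_measurable_scaleR)
    qed
    then show "(\<integral>x. u x *\<^sub>R (G x - H x) \<partial>unit_leb) = 0"
      using assms u int has_weak_deriv_2_represented_by[OF rep(1,2)] has_weak_deriv_2_represented_by[OF rep(1,3)]
      by (simp add: scaleR_diff_right)
  qed
  then show ?thesis by (intro represented_by_eqI[OF rep(2,3)]) auto
qed

lemma weak_deriv2_eq: "has_weak_deriv 2 f g \<Longrightarrow> weak_deriv2 f = g"
  unfolding weak_deriv2_def using has_weak_deriv_2_unique by blast

text \<open>The integral equation says that \<open>F'\<close> is absolutely continuous with density
  \<open>G\<close>, a representative of the weak second derivative. \<open>Dom_D_repD\<close> and
  \<open>Dom_D_repE\<close> show that \<open>Dom_D\<close> consists of the classes with such data,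
  so later arguments can avoid test functions.\<close>

definition Dom_D_rep :: "L2 \<Rightarrow> (real \<Rightarrow> complex^2) \<Rightarrow> (real \<Rightarrow> complex^2) \<Rightarrow> (real \<Rightarrow> complex^2) \<Rightarrow> bool" where
  "Dom_D_rep f F F' G \<longleftrightarrow> represented_by f F \<and> sq_integrable G \<and> has_deriv_unit F F' \<and>
     (\<forall>x\<in>{0..1}. F' x = F' 0 + integral {0..x} G) \<and>
     F 0 $ 1 = 0 \<and> F 1 $ 1 = 0 \<and> F' 0 $ 2 = 0 \<and> F' 1 $ 2 = 0"

lemma indefinite_continuous:
  fixes G :: "real \<Rightarrow> 'a::euclidean_space"
  assumes "integrable unit_leb G" and "\<forall>x\<in>{0..1}. F' x = F' 0 + integral {0..x} G"
  shows "continuous_on {0..1} F'"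
proof -
  have "continuous_on {0..1} (\<lambda>x. F' 0 + integral {0..x} G)"
    by (intro continuous_intros indefinite_integral_facts assms)
  then show ?thesis
    by (rule continuous_on_eq) (use assms(2) in metis)
qed

lemma Dom_D_repD:
  assumes "Dom_D_rep f F F' G"
  shows "f \<in> Dom_D" "represented_by (weak_deriv2 f) G" "continuous_on {0..1} F'"
proof -
  have f: "represented_by f F" and G: "sq_integrable G" "represented_by (abs_L2 G) G"
    and d: "has_deriv_unit F F'" and i: "\<forall>x\<in>{0..1}. F' x = F' 0 + integral {0..x} G"
    using assms represented_by_abs unfolding Dom_D_rep_def by blast+
  note ig = sq_integrable_imp_integrable[OF G(1)]
  show c: "continuous_on {0..1} F'" by (rule indefinite_continuous[OF ig i])
  have w: "has_weak_deriv 2 f (abs_L2 G)"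
    unfolding has_weak_deriv_2_represented_by[OF f G(2)] weak_second_deriv_iff[OF d c ig] by (rule i)
  then show "represented_by (weak_deriv2 f) G"
    using G(2) by (simp add: weak_deriv2_eq)
  show "f \<in> Dom_D"
    using assms w c unfolding Dom_D_def W22_def Dom_D_rep_def by blast
qed

lemma Dom_D_repE:
  assumes "f \<in> Dom_D"
  obtains F F' G where "Dom_D_rep f F F' G"
proof -
  obtain F F' where f: "represented_by f F" and d: "has_deriv_unit F F'" and c: "continuous_on {0..1} F'"
    and bc: "F 0 $ 1 = 0" "F 1 $ 1 = 0" "F' 0 $ 2 = 0" "F' 1 $ 2 = 0"
    using assms by (auto simp: Dom_D_def)
  obtain g where g: "has_weak_deriv 2 f g"
    using assms by (auto simp: Dom_D_def W22_def)
  obtain G where G: "represented_by g G" by (rule represented_by_ex)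
  have "\<forall>x\<in>{0..1}. F' x = F' 0 + integral {0..x} G"
    using g unfolding has_weak_deriv_2_represented_by[OF f G]
      weak_second_deriv_iff[OF d c represented_by_integrable[OF G]] .
  then have "Dom_D_rep f F F' G"
    using f d bc represented_by_sq_integrable[OF G] unfolding Dom_D_rep_def by blast
  then show thesis by (rule that)
qed

lemma integrable_unit_leb_subinterval:
  fixes G :: "real \<Rightarrow> 'a::euclidean_space"
  assumes "integrable unit_leb G" "x \<in> {0..1}"
  shows "G integrable_on {0..x}"
  by (rule integrable_on_subinterval[OF integrable_unit_leb_integral(1)[OF assms(1)]]) (use assms(2) in auto)

lemma Dom_D_rep_add:
  assumes "Dom_D_rep f F F' G" "Dom_D_rep e E E' H"
  shows "Dom_D_rep (f + e) (\<lambda>x. F x + E x) (\<lambda>x. F' x + E' x) (\<lambda>x. G x + H x)"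
proof -
  have a: "integral {0..x} (\<lambda>t. G t + H t) = integral {0..x} G + integral {0..x} H" if "x \<in> {0..1}" for x
    using assms that by (intro integral_add integrable_unit_leb_subinterval sq_integrable_imp_integrable)
      (blast dest: Dom_D_rep_def[THEN iffD1])+
  have i: "F' x + E' x = F' 0 + E' 0 + integral {0..x} (\<lambda>t. G t + H t)" if "x \<in> {0..1}" for x
  proof -
    have "F' x = F' 0 + integral {0..x} G" "E' x = E' 0 + integral {0..x} H"
      using assms that unfolding Dom_D_rep_def by blast+
    then show ?thesis unfolding a[OF that] by (metis (no_types, lifting) add.assoc add.left_commute)
  qed
  have "sq_integrable (\<lambda>x. G x + H x)" "represented_by (f + e) (\<lambda>x. F x + E x)"
    "has_deriv_unit (\<lambda>x. F x + E x) (\<lambda>x. F' x + E' x)"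
    using assms unfolding Dom_D_rep_def
    by (blast intro: represented_by_add sq_integrable_add has_vector_derivative_add)+
  moreover have "(F 0 + E 0) $ 1 = 0" "(F 1 + E 1) $ 1 = 0" "(F' 0 + E' 0) $ 2 = 0" "(F' 1 + E' 1) $ 2 = 0"
    using assms unfolding Dom_D_rep_def vector_add_component by (metis add_0)+
  ultimately show ?thesis
    using i unfolding Dom_D_rep_def by blast
qed

lemma Dom_D_rep_scaleR:
  assumes "Dom_D_rep f F F' G"
  shows "Dom_D_rep (c *\<^sub>R f) (\<lambda>x. c *\<^sub>R F x) (\<lambda>x. c *\<^sub>R F' x) (\<lambda>x. c *\<^sub>R G x)"
proof -
  have i: "c *\<^sub>R F' x = c *\<^sub>R F' 0 + integral {0..x} (\<lambda>t. c *\<^sub>R G t)" if "x \<in> {0..1}" for x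
  proof -
    have "F' x = F' 0 + integral {0..x} G"
      using assms that unfolding Dom_D_rep_def by blast
    then show ?thesis unfolding integral_cmul by (metis scaleR_add_right)
  qed
  have "sq_integrable (\<lambda>x. c *\<^sub>R G x)" "represented_by (c *\<^sub>R f) (\<lambda>x. c *\<^sub>R F x)"
    "has_deriv_unit (\<lambda>x. c *\<^sub>R F x) (\<lambda>x. c *\<^sub>R F' x)"
    using assms unfolding Dom_D_rep_def
    by (blast intro: represented_by_scaleR sq_integrable_scaleR
        bounded_linear.has_vector_derivative[OF bounded_linear_scaleR_right])+
  moreover have "(c *\<^sub>R F 0) $ 1 = 0" "(c *\<^sub>R F 1) $ 1 = 0" "(c *\<^sub>R F' 0) $ 2 = 0" "(c *\<^sub>R F' 1) $ 2 = 0"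
    using assms unfolding Dom_D_rep_def vector_scaleR_component by (metis scaleR_zero_right)+
  ultimately show ?thesis
    using i unfolding Dom_D_rep_def by blast
qed

lemma weak_deriv2_add:
  assumes "f \<in> Dom_D" "e \<in> Dom_D"
  shows "f + e \<in> Dom_D" "weak_deriv2 (f + e) = weak_deriv2 f + weak_deriv2 e"
proof -
  obtain F F' G E E' H where r: "Dom_D_rep f F F' G" "Dom_D_rep e E E' H"
    using assms Dom_D_repE by metis
  note a = Dom_D_rep_add[OF r]
  show "f + e \<in> Dom_D" by (rule Dom_D_repD(1)[OF a])
  show "weak_deriv2 (f + e) = weak_deriv2 f + weak_deriv2 e"
    by (rule represented_by_eqI[OF Dom_D_repD(2)[OF a]
          represented_by_add[OF Dom_D_repD(2)[OF r(1)] Dom_D_repD(2)[OF r(2)]]]) simp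
qed

lemma weak_deriv2_scaleR:
  assumes "f \<in> Dom_D"
  shows "c *\<^sub>R f \<in> Dom_D" "weak_deriv2 (c *\<^sub>R f) = c *\<^sub>R weak_deriv2 f"
proof -
  obtain F F' G where r: "Dom_D_rep f F F' G"
    using assms Dom_D_repE by metis
  note a = Dom_D_rep_scaleR[OF r, of c]
  show "c *\<^sub>R f \<in> Dom_D" by (rule Dom_D_repD(1)[OF a])
  show "weak_deriv2 (c *\<^sub>R f) = c *\<^sub>R weak_deriv2 f"
    by (rule represented_by_eqI[OF Dom_D_repD(2)[OF a]
          represented_by_scaleR[OF Dom_D_repD(2)[OF r]]]) simp
qed

section \<open>Matrices and complex scalars acting on \<open>L2\<close>\<close>

lemma linear_matrix_L2: "linear (matrix_L2 A)"
proof (rule linearI)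
  fix f g c
  obtain F G where r: "represented_by f F" "represented_by g G"
    using represented_by_ex by metis
  show "matrix_L2 A (f + g) = matrix_L2 A f + matrix_L2 A g"
    by (rule represented_by_eqI, (rule represented_by_intros r)+) (simp add: matrix_vector_right_distrib)
  show "matrix_L2 A (c *\<^sub>R f) = c *\<^sub>R matrix_L2 A f"
    by (rule represented_by_eqI, (rule represented_by_intros r)+)
      (simp add: linear_scale[OF bounded_linear.linear[OF bounded_linear_matrix_vec]])
qed

lemma linear_scaleC_L2: "linear (scaleC_L2 z)"
proof (rule linearI)
  fix f g c
  obtain F G where r: "represented_by f F" "represented_by g G"
    using represented_by_ex by metis
  show "scaleC_L2 z (f + g) = scaleC_L2 z f + scaleC_L2 z g"
    by (rule represented_by_eqI, (rule represented_by_intros r)+) (simp add: vector_add_ldistrib)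
  show "scaleC_L2 z (c *\<^sub>R f) = c *\<^sub>R scaleC_L2 z f"
    by (rule represented_by_eqI, (rule represented_by_intros r)+)
      (simp add: linear_scale[OF bounded_linear.linear[OF bounded_linear_scale_vec]])
qed

lemma op_AD_add:
  assumes "f \<in> Dom_D" "e \<in> Dom_D"
  shows "op_AD A (f + e) = op_AD A f + op_AD A e"
  using weak_deriv2_add[OF assms] linear_add[OF linear_matrix_L2, of A "- weak_deriv2 f" "- weak_deriv2 e"]
  by (simp add: op_AD_def op_D_def)

lemma op_AD_scaleR:
  assumes "f \<in> Dom_D"
  shows "op_AD A (c *\<^sub>R f) = c *\<^sub>R op_AD A f"
  using weak_deriv2_scaleR[OF assms] linear_scale[OF linear_matrix_L2, of A c "- weak_deriv2 f"]
  by (simp add: op_AD_def op_D_def)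

lemma matrix_L2_matrix_mult: "matrix_L2 (X ** Y) f = matrix_L2 X (matrix_L2 Y f)"
proof -
  obtain F where r: "represented_by f F" by (rule represented_by_ex)
  show ?thesis
    by (rule represented_by_eqI, (rule represented_by_intros r)+) (simp add: matrix_vector_mul_assoc)
qed

lemma matrix_L2_matrix_add: "matrix_L2 (X + Y) f = matrix_L2 X f + matrix_L2 Y f"
proof -
  obtain F where r: "represented_by f F" by (rule represented_by_ex)
  show ?thesis
    by (rule represented_by_eqI, (rule represented_by_intros r)+) (simp add: matrix_vector_mult_add_rdistrib)
qed

lemma matrix_L2_mat_1: "matrix_L2 (mat 1) f = f"
proof -
  obtain F where r: "represented_by f F" by (rule represented_by_ex)
  show ?thesis
    by (rule represented_by_eqI[OF represented_by_matrix[OF r] r]) simp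
qed

text \<open>In the real inner product space \<open>L2\<close> a complex scalar is reduced to real
  ones and the map \<open>scaleC_L2 \<i>\<close>, which is an isometry and sends each
  \<open>f\<close> to a vector orthogonal to it, by the next two lemmas.\<close>

lemma scaleC_L2_eq: "scaleC_L2 z f = Re z *\<^sub>R f + Im z *\<^sub>R scaleC_L2 \<i> f"
proof -
  obtain F where r: "represented_by f F" by (rule represented_by_ex)
  show ?thesis
    by (rule represented_by_eqI, (rule represented_by_intros r)+)
      (auto intro!: AE_I2 simp: vec_eq_iff complex_eq_iff)
qed

lemma inner_scaleC_ii: "f \<bullet> scaleC_L2 \<i> f = 0"
proof -
  obtain F where r: "represented_by f F" by (rule represented_by_ex)
  show ?thesis
    unfolding inner_represented_by[OF r represented_by_scaleC[OF r]]
    by (simp add: inner_vec_def sum_2 inner_complex_def)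
qed

lemma norm_scaleC_ii: "norm (scaleC_L2 \<i> f) = norm f"
proof -
  obtain F where r: "represented_by f F" by (rule represented_by_ex)
  have "(norm (scaleC_L2 \<i> f))\<^sup>2 = (norm f)\<^sup>2"
    unfolding norm_represented_by[OF r] norm_represented_by[OF represented_by_scaleC[OF r]]
    by (simp add: power2_norm_eq_inner inner_vec_def sum_2 inner_complex_def add.commute)
  then show ?thesis by simp
qed

lemma matrix_norm_nonneg: "0 \<le> matrix_norm C"
  unfolding matrix_norm_def by (rule onorm_pos_le[OF bounded_linear_matrix_vec])

lemma norm_matrix_vec_le: "norm (C *v v) \<le> matrix_norm C * norm v"
  unfolding matrix_norm_def by (rule onorm[OF bounded_linear_matrix_vec])

lemma norm_matrix_L2_le: "norm (matrix_L2 C f) \<le> matrix_norm C * norm f"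
proof -
  obtain F where r: "represented_by f F" by (rule represented_by_ex)
  have "(norm (matrix_L2 C f))\<^sup>2 \<le> (\<integral>x. (matrix_norm C)\<^sup>2 * (norm (F x))\<^sup>2 \<partial>unit_leb)"
    unfolding norm_represented_by[OF represented_by_matrix[OF r]]
  proof (rule integral_mono)
    show "integrable unit_leb (\<lambda>x. (norm (C *v F x))\<^sup>2)"
      using represented_by_sq_integrable[OF represented_by_matrix[OF r, of C]] by (simp add: sq_integrable_def)
    show "integrable unit_leb (\<lambda>x. (matrix_norm C)\<^sup>2 * (norm (F x))\<^sup>2)"
      using represented_by_sq_integrable[OF r] by (simp add: sq_integrable_def)
    show "(norm (C *v F x))\<^sup>2 \<le> (matrix_norm C)\<^sup>2 * (norm (F x))\<^sup>2" for x
      using power_mono[OF norm_matrix_vec_le[of C "F x"], of 2] by (simp add: power_mult_distrib)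
  qed
  also have "\<dots> = (matrix_norm C * norm f)\<^sup>2"
    by (simp add: norm_represented_by[OF r] power_mult_distrib)
  finally show ?thesis
    by (rule power2_le_imp_le) (simp add: matrix_norm_nonneg)
qed

section \<open>The resolvent estimate\<close>

lemma invertible_real_diagonal_inverse:
  assumes "real_diagonal B" "invertible B"
  obtains B' where "real_diagonal B'" "B ** B' = mat 1" "B' ** B = mat 1"
proof -
  have nz: "B $ i $ i \<noteq> 0" for i
  proof
    assume 0: "B $ i $ i = 0"
    obtain X where "B ** X = mat 1" using assms(2) by (auto simp: invertible_def)
    then have "(B ** X) $ i $ i = 1" by (simp add: mat_def)
    moreover have "B $ i $ j = 0" for j
      using assms(1) 0 by (cases "i = j") (auto simp: real_diagonal_def)
    ultimately show False by (simp add: matrix_matrix_mult_def)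
  qed
  \<comment> \<open>Entrywise inversion suffices: \<open>inverse 0 = 0\<close> keeps the
    off-diagonal zeros.\<close>
  define B' :: "complex^2^2" where "B' = (\<chi> i j. inverse (B $ i $ j))"
  have "real_diagonal B'" using assms(1) by (simp add: real_diagonal_def B'_def)
  moreover have "B ** B' = mat 1" "B' ** B = mat 1"
    using assms(1) nz by (simp_all add: vec_eq_iff forall_2 matrix_matrix_mult_def sum_2 mat_def B'_def real_diagonal_def)
  ultimately show thesis by (rule that)
qed

text \<open>In each component the real inner product with \<open>\<i>\<close> times b is the
  imaginary part of a times the conjugate of b; a real diagonal \<open>R\<close> only multiplies it
  by a real number.\<close>

lemma inner_real_diagonal_ii:
  assumes "real_diagonal R" and "\<And>i. a $ i * cnj (b $ i) \<in> \<real>"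
  shows "(R *v a) \<bullet> (\<i> *s b) = 0"
proof -
  have "(R *v a) $ i \<bullet> (\<i> *s b) $ i = 0" for i
  proof -
    obtain r where r: "R $ i $ i = of_real r"
      using assms(1) unfolding real_diagonal_def by (metis Reals_cases)
    have "R $ 1 $ 2 = 0" "R $ 2 $ 1 = 0"
      using assms(1) by (auto simp: real_diagonal_def)
    then have "(R *v a) $ i = R $ i $ i * a $ i"
      using exhaust_2[of i] by (auto simp: matrix_vector_mult_def sum_2)
    then show ?thesis
      using assms(2)[of i] r by (simp add: inner_complex_def complex_is_Real_iff algebra_simps)
  qed
  then show ?thesis by (simp add: inner_vec_def)
qed

text \<open>The quadratic form of \<open>R D\<close> is real for a real diagonal \<open>R\<close>, since such an \<open>R\<close> respects the
  boundary conditions of both components.\<close>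

lemma inner_real_diagonal_weak_deriv2:
  assumes R: "real_diagonal R" and f: "f \<in> Dom_D"
  shows "matrix_L2 R (op_D f) \<bullet> scaleC_L2 \<i> f = 0"
proof -
  obtain F F' G where r: "Dom_D_rep f F F' G" using Dom_D_repE[OF f] .
  define p :: "complex^2 \<Rightarrow> complex^2 \<Rightarrow> real" where "p a b = (R *v a) \<bullet> (\<i> *s b)" for a b
  have p: "bounded_bilinear p"
    unfolding p_def[abs_def]
    by (rule bounded_bilinear.comp[OF bounded_bilinear_inner bounded_linear_matrix_vec bounded_linear_scale_vec])
  have p0: "p a a = 0" for a
    unfolding p_def by (rule inner_real_diagonal_ii[OF R]) (simp add: complex_is_Real_iff)
  \<comment> \<open>Meant for the boundary terms: at both end points the first component of
    \<open>F\<close> and the second component of \<open>F'\<close> vanish, so every componentwise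
    product has a zero factor.\<close>
  have pb: "p a b = 0" if "b $ 1 = 0" "a $ 2 = 0" for a b
    unfolding p_def
  proof (rule inner_real_diagonal_ii[OF R])
    show "a $ i * cnj (b $ i) \<in> \<real>" for i
      using that exhaust_2[of i] by auto
  qed
  have rep: "represented_by f F" and G: "integrable unit_leb G"
    and d: "has_deriv_unit F F'" and i: "\<forall>x\<in>{0..1}. F' x = F' 0 + integral {0..x} G"
    and bc: "F 0 $ 1 = 0" "F 1 $ 1 = 0" "F' 0 $ 2 = 0" "F' 1 $ 2 = 0"
    using r sq_integrable_imp_integrable unfolding Dom_D_rep_def by blast+
  have "matrix_L2 R (weak_deriv2 f) \<bullet> scaleC_L2 \<i> f = (\<integral>x. p (G x) (F x) \<partial>unit_leb)"
    unfolding p_def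
    by (rule inner_represented_by[OF represented_by_matrix[OF Dom_D_repD(2)[OF r]] represented_by_scaleC[OF rep]])
  also have "\<dots> = p (F' 1) (F 1) - p (F' 0) (F 0) - (\<integral>x. p (F' x) (F' x) \<partial>unit_leb)"
    by (rule integration_by_parts_unit[OF p G bspec[OF i] bspec[OF d] Dom_D_repD(3)[OF r]])
  also have "\<dots> = 0"
    using pb bc by (simp add: p0)
  finally show ?thesis
    using linear_neg[OF linear_matrix_L2, of R "weak_deriv2 f"] by (simp add: op_D_def)
qed

lemma resolvent_estimate:
  assumes R: "real_diagonal B" "invertible B" and f: "f \<in> Dom_D"
  shows "(\<bar>Im z\<bar> - matrix_norm (A ** B - mat 1) * cmod z) * norm f \<le> norm (op_AD A f - scaleC_L2 z f)"
\<comment> \<open>A nonpositive factor makes the claim trivial; a positive one forces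
  \<open>z\<close> off the real axis, which the later cancellation of
  \<open>\<bar>Im z\<bar>\<close> requires.\<close>
proof (cases "\<bar>Im z\<bar> - matrix_norm (A ** B - mat 1) * cmod z > 0")
  case False
  then have "(\<bar>Im z\<bar> - matrix_norm (A ** B - mat 1) * cmod z) * norm f \<le> 0"
    by (intro mult_nonpos_nonneg) auto
  then show ?thesis using norm_ge_zero order_trans by blast
next
  case True
  obtain B' where B': "real_diagonal B'" "B ** B' = mat 1"
    using invertible_real_diagonal_inverse[OF R] by metis
  define C where "C = A ** B - mat 1"
  define s where "s = matrix_norm C"
  define h where "h = matrix_L2 B' (op_D f)"
  define g where "g = op_AD A f - scaleC_L2 z f"
  define N where "N = norm (h - scaleC_L2 z f)"
  have y: "\<bar>Im z\<bar> - s * cmod z > 0" using True by (simp add: s_def C_def)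
  have s0: "s \<ge> 0" unfolding s_def by (rule matrix_norm_nonneg)
  have y0: "\<bar>Im z\<bar> > 0" using y s0 by (smt (verit) mult_nonneg_nonneg norm_ge_zero)
  have z0: "cmod z > 0" using y0 by auto
  have "A = (A ** B) ** B'" using B'(2) by (simp add: matrix_mul_assoc[symmetric])
  also have "A ** B = C + mat 1" by (simp add: C_def)
  finally have A: "A = (C + mat 1) ** B'" .
  have "op_AD A f = matrix_L2 C h + h"
    unfolding op_AD_def h_def by (subst A) (simp add: matrix_L2_matrix_mult matrix_L2_matrix_add matrix_L2_mat_1)
  then have "h - scaleC_L2 z f = g - matrix_L2 C h" by (simp add: g_def)
  then have N1: "N \<le> norm g + s * norm h"
    unfolding N_def s_def using norm_triangle_ineq4[of g "matrix_L2 C h"] norm_matrix_L2_le[of C h] by simp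
  have hf: "h \<bullet> scaleC_L2 \<i> f = 0"
    unfolding h_def by (rule inner_real_diagonal_weak_deriv2[OF B'(1) f])
  define a b where "a = norm h" and "b = norm f"
  have a0: "a \<ge> 0" and b0: "b \<ge> 0" by (auto simp: a_def b_def)
  \<comment> \<open>\<open>h\<close> and \<open>f\<close> are both orthogonal to
    \<open>scaleC_L2 \<i> f\<close>, which removes every cross term containing
    \<open>Im z\<close>.\<close>
  have N2: "N\<^sup>2 = a\<^sup>2 - 2 * Re z * (h \<bullet> f) + (Re z)\<^sup>2 * b\<^sup>2 + (Im z)\<^sup>2 * b\<^sup>2"
  proof -
    have "N\<^sup>2 = (h - Re z *\<^sub>R f - Im z *\<^sub>R scaleC_L2 \<i> f) \<bullet> (h - Re z *\<^sub>R f - Im z *\<^sub>R scaleC_L2 \<i> f)"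
      unfolding N_def power2_norm_eq_inner scaleC_L2_eq[of z] by (simp add: algebra_simps)
    moreover have "scaleC_L2 \<i> f \<bullet> scaleC_L2 \<i> f = b\<^sup>2"
      using norm_scaleC_ii[of f] by (simp add: b_def power2_norm_eq_inner[symmetric])
    moreover have "f \<bullet> f = b\<^sup>2" "h \<bullet> h = a\<^sup>2"
      by (simp_all add: a_def b_def power2_norm_eq_inner)
    ultimately show ?thesis
      using hf inner_scaleC_ii[of f]
      by (simp add: inner_diff_left inner_diff_right inner_commute algebra_simps power2_eq_square)
  qed
  have hfab: "\<bar>h \<bullet> f\<bar> \<le> a * b"
    unfolding a_def b_def by (rule Cauchy_Schwarz_ineq2)
  have low: "N\<^sup>2 \<ge> a\<^sup>2 - 2 * \<bar>Re z\<bar> * a * b + (Re z)\<^sup>2 * b\<^sup>2 + (Im z)\<^sup>2 * b\<^sup>2"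
  proof -
    have "Re z * (h \<bullet> f) \<le> \<bar>Re z\<bar> * \<bar>h \<bullet> f\<bar>" by (metis abs_ge_self abs_mult)
    also have "\<dots> \<le> \<bar>Re z\<bar> * (a * b)" by (intro mult_left_mono hfab) simp
    finally show ?thesis unfolding N2 by simp
  qed
  \<comment> \<open>The lower bound \<open>low\<close> is the square of
    \<open>\<bar>Im z\<bar> * b\<close> plus the square of
    \<open>a - \<bar>Re z\<bar> * b\<close>.\<close>
  have "(\<bar>Im z\<bar> * b)\<^sup>2 \<le> N\<^sup>2"
    using low zero_le_power2[of "a - \<bar>Re z\<bar> * b"] by (simp add: power2_eq_square algebra_simps)
  then have Nf: "\<bar>Im z\<bar> * b \<le> N" by (rule power2_le_imp_le) (simp add: N_def)
  have "(\<bar>Im z\<bar> * a)\<^sup>2 \<le> (cmod z * N)\<^sup>2"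
  proof -
    have z2: "(cmod z)\<^sup>2 = (Re z)\<^sup>2 + (Im z)\<^sup>2" by (rule cmod_power2)
    \<comment> \<open>The same form, now with the square completed in \<open>b\<close>.\<close>
    have "(cmod z)\<^sup>2 * (a\<^sup>2 - 2 * \<bar>Re z\<bar> * a * b + (Re z)\<^sup>2 * b\<^sup>2 + (Im z)\<^sup>2 * b\<^sup>2) =
       (Im z)\<^sup>2 * a\<^sup>2 + (\<bar>Re z\<bar> * a - (cmod z)\<^sup>2 * b)\<^sup>2"
      unfolding z2 by (simp add: power2_eq_square algebra_simps)
    then have "(Im z)\<^sup>2 * a\<^sup>2 \<le> (cmod z)\<^sup>2 * N\<^sup>2"
      using mult_left_mono[OF low, of "(cmod z)\<^sup>2"] by (smt (verit) zero_le_power2)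
    then show ?thesis by (simp add: power_mult_distrib)
  qed
  then have Nh: "\<bar>Im z\<bar> * a \<le> cmod z * N" by (rule power2_le_imp_le) (simp add: N_def)
  \<comment> \<open>\<open>Nh\<close> bounds the perturbation term \<open>s * norm h\<close> of
    \<open>N1\<close> by a multiple of \<open>N\<close>, to be absorbed on the left; multiplying by
    \<open>\<bar>Im z\<bar>\<close> avoids divisions.\<close>
  have "\<bar>Im z\<bar> * N \<le> \<bar>Im z\<bar> * norm g + s * (\<bar>Im z\<bar> * a)"
    using mult_left_mono[OF N1, of "\<bar>Im z\<bar>"] by (simp add: a_def algebra_simps)
  also have "\<dots> \<le> \<bar>Im z\<bar> * norm g + s * (cmod z * N)"
    using mult_left_mono[OF Nh s0] by simp
  finally have "(\<bar>Im z\<bar> - s * cmod z) * N \<le> \<bar>Im z\<bar> * norm g" by (simp add: algebra_simps)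
  moreover have "(\<bar>Im z\<bar> - s * cmod z) * (\<bar>Im z\<bar> * b) \<le> (\<bar>Im z\<bar> - s * cmod z) * N"
    using y by (intro mult_left_mono Nf) simp
  ultimately have "\<bar>Im z\<bar> * ((\<bar>Im z\<bar> - s * cmod z) * b) \<le> \<bar>Im z\<bar> * norm g" by (simp add: algebra_simps)
  then have "(\<bar>Im z\<bar> - s * cmod z) * b \<le> norm g"
    using y0 by (simp only: mult_le_cancel_left_pos)
  then show ?thesis by (simp add: s_def C_def b_def g_def)
qed

text \<open>For an argument t of z, |Im z| is |z| times |sin t|, and |sin t| \<le> sin w confines t
  to within w of a multiple of pi. The three cases reduce this to the interval from -pi/2 to pi/2,
  where sin is increasing.\<close>

lemma abs_Im_gt_outside_sectors:
  assumes w: "0 \<le> w" "w < pi / 2"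
    and z: "z \<notin> sector (- w) w \<union> sector (- pi - w) (w - pi)"
  shows "sin w * cmod z < \<bar>Im z\<bar>"
proof (rule ccontr)
  assume "\<not> ?thesis"
  then have le: "\<bar>Im z\<bar> \<le> sin w * cmod z" by simp
  have z0: "z \<noteq> 0" using z unfolding sector_def by blast
  define t where "t = Arg z"
  have t: "- pi < t" "t \<le> pi" using Arg_bounded[of z] by (auto simp: t_def)
  have zt: "is_Arg z t" unfolding t_def using z0 by (rule is_Arg_Arg)
  then have "Im z = Im (of_real (cmod z) * exp (\<i> * of_real t))"
    unfolding is_Arg_def by (rule arg_cong)
  then have im: "Im z = cmod z * sin t"
    by (simp add: Im_exp)
  then have sin: "\<bar>sin t\<bar> \<le> sin w"
    using le z0 by (simp add: abs_mult mult.commute)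
  have out: "\<not> (- w \<le> \<theta> \<and> \<theta> \<le> w)" "\<not> (- pi - w \<le> \<theta> \<and> \<theta> \<le> w - pi)" if "is_Arg z \<theta>" for \<theta>
    using that z by (auto simp: sector_def)
  consider "- pi / 2 \<le> t" "t \<le> pi / 2" | "t > pi / 2" | "t < - pi / 2" by linarith
  then show False
  proof cases
    case 1
    have "t \<le> w"
    proof (rule ccontr)
      assume "\<not> t \<le> w"
      then have "sin (w) < sin (t)"
        using 1 w by (intro sin_monotone_2pi) auto
      then show False using sin by simp
    qed
    moreover have "- w \<le> t"
    proof (rule ccontr)
      assume "\<not> - w \<le> t"
      then have "sin (t) < sin (- w)"
        using 1 w by (intro sin_monotone_2pi) auto
      then show False using sin by simp
    qed
    ultimately show False using out(1)[OF zt] by blast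
  next
    case 2
    have "pi - t \<le> w"
    proof (rule ccontr)
      assume "\<not> pi - t \<le> w"
      then have "sin (w) < sin (pi - t)"
        using 2 w by (intro sin_monotone_2pi) auto
      then show False using sin by simp
    qed
    \<comment> \<open>The second sector is centred at -pi, whereas \<open>Arg\<close> takes values
      up to pi; arguments near pi are lowered by a full turn.\<close>
    moreover have "is_Arg z (t - 2 * pi)"
      using is_Arg_2pi_iff[of z t "-1"] zt by simp
    ultimately show False using out(2)[of "t - 2 * pi"] t w by auto
  next
    case 3
    have "t + pi \<le> w"
    proof (rule ccontr)
      assume "\<not> t + pi \<le> w"
      then have "sin (w) < sin (t + pi)"
        using 3 w by (intro sin_monotone_2pi) auto
      then show False using sin by simp
    qed
    then show False using out(2)[OF zt] t w by auto
  qed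
qed

section \<open>Surjectivity\<close>

text \<open>The equation F'' = M F + h in integral form: \<open>h\<close> is only square integrable,
  so the pointwise equation may fail on a null set. The form matches
  \<open>Dom_D_rep\<close>.\<close>

definition ode_solution :: "complex^2^2 \<Rightarrow> (real \<Rightarrow> complex^2) \<Rightarrow> (real \<Rightarrow> complex^2) \<Rightarrow> (real \<Rightarrow> complex^2) \<Rightarrow> bool" where
  "ode_solution M h F F' \<longleftrightarrow> sq_integrable h \<and> has_deriv_unit F F' \<and>
     (\<forall>x\<in>{0..1}. F' x = F' 0 + integral {0..x} (\<lambda>t. M *v F t + h t))"

lemma ode_solution_sq_integrable:
  assumes "ode_solution M h F F'"
  shows "sq_integrable F" "sq_integrable (\<lambda>t. M *v F t + h t)"
proof -
  have d: "has_deriv_unit F F'" and h: "sq_integrable h"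
    using assms unfolding ode_solution_def by blast+
  show F: "sq_integrable F"
    by (rule sq_integrable_continuous[OF has_deriv_unit_continuous[OF d]])
  show "sq_integrable (\<lambda>t. M *v F t + h t)"
    by (rule sq_integrable_add[OF sq_integrable_bounded_linear[OF F bounded_linear_matrix_vec] h])
qed

text \<open>Subtracting the second antiderivative \<open>K\<close> of \<open>h\<close> from the
  unknown leaves an equation with the continuous inhomogeneity \<open>M *v K x\<close>, covered by
  \<open>vector_second_order_ode\<close>. \<open>K\<close> and \<open>H\<close> vanish at 0, so the
  initial data are unchanged.\<close>

lemma ode_solution_exists:
  fixes M :: "complex^2^2"
  assumes h: "sq_integrable h"
  shows "\<exists>F F'. ode_solution M h F F' \<and> F 0 = p \<and> F' 0 = q"
proof -
  note ih = sq_integrable_imp_integrable[OF h]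
  define H where "H x = integral {0..x} h" for x
  define K where "K x = integral {0..x} H" for x
  have Hc: "continuous_on {0..1} H"
    unfolding H_def by (rule indefinite_integral_facts(1)[OF ih])
  have K: "has_deriv_unit K H"
    unfolding K_def by (intro ballI integral_has_vector_derivative Hc) auto
  note Kc = has_deriv_unit_continuous[OF K]
  have "continuous_on {0..1} (\<lambda>x. M *v K x)"
    by (rule bounded_linear.continuous_on[OF bounded_linear_matrix_vec Kc])
  then obtain u u' where u: "u 0 = p" "u' 0 = q" "has_deriv_unit u u'"
    "has_deriv_unit u' (\<lambda>x. M *v u x + M *v K x)"
    using vector_second_order_ode by blast
  have "ode_solution M h (\<lambda>x. u x + K x) (\<lambda>x. u' x + H x)"
    unfolding ode_solution_def
  proof (intro conjI ballI)
    show "sq_integrable h" by (rule h)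
    fix x :: real assume x: "x \<in> {0..1}"
    show "((\<lambda>x. u x + K x) has_vector_derivative u' x + H x) (at x within {0..1})"
      using u(3) K x by (intro has_vector_derivative_add) auto
    have "((\<lambda>t. M *v u t + M *v K t) has_integral u' x - u' 0) {0..x}"
      using x by (intro fundamental_theorem_of_calculus
          has_vector_derivative_within_subset[OF bspec[OF u(4)]]) auto
    moreover have "(h has_integral H x) {0..x}"
      unfolding H_def using integrable_unit_leb_subinterval[OF ih x] by (rule integrable_integral)
    ultimately have "((\<lambda>t. M *v u t + M *v K t + h t) has_integral u' x - u' 0 + H x) {0..x}"
      by (rule has_integral_add)
    then have "integral {0..x} (\<lambda>t. M *v (u t + K t) + h t) = u' x - u' 0 + H x"
      by (simp add: matrix_vector_right_distrib integral_unique)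
    then show "u' x + H x = u' 0 + H 0 + integral {0..x} (\<lambda>t. M *v (u t + K t) + h t)"
      by (simp add: H_def)
  qed
  then show ?thesis
    using u(1,2) by (intro exI[of _ "\<lambda>x. u x + K x"] exI[of _ "\<lambda>x. u' x + H x"]) (simp add: K_def H_def)
qed

lemma ode_solution_add:
  assumes "ode_solution M h F F'" "ode_solution M k E E'"
  shows "ode_solution M (\<lambda>x. h x + k x) (\<lambda>x. F x + E x) (\<lambda>x. F' x + E' x)"
  unfolding ode_solution_def
proof (intro conjI ballI)
  show "sq_integrable (\<lambda>x. h x + k x)"
    using assms sq_integrable_add unfolding ode_solution_def by blast
  fix x :: real assume x: "x \<in> {0..1}"
  show "((\<lambda>x. F x + E x) has_vector_derivative F' x + E' x) (at x within {0..1})"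
    using assms x has_vector_derivative_add unfolding ode_solution_def by blast
  have i: "F' x = F' 0 + integral {0..x} (\<lambda>t. M *v F t + h t)"
    "E' x = E' 0 + integral {0..x} (\<lambda>t. M *v E t + k t)"
    using assms x unfolding ode_solution_def by blast+
  have "integral {0..x} (\<lambda>t. M *v (F t + E t) + (h t + k t)) =
      integral {0..x} (\<lambda>t. (M *v F t + h t) + (M *v E t + k t))"
    by (simp add: matrix_vector_right_distrib algebra_simps)
  also have "\<dots> = integral {0..x} (\<lambda>t. M *v F t + h t) + integral {0..x} (\<lambda>t. M *v E t + k t)"
    using assms x by (intro integral_add integrable_unit_leb_subinterval sq_integrable_imp_integrable
        ode_solution_sq_integrable)
  finally show "F' x + E' x = F' 0 + E' 0 + integral {0..x} (\<lambda>t. M *v (F t + E t) + (h t + k t))"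
    by (subst i(1), subst i(2)) simp
qed

lemma ode_solution_scale:
  assumes "ode_solution M h F F'"
  shows "ode_solution M (\<lambda>x. c *s h x) (\<lambda>x. c *s F x) (\<lambda>x. c *s F' x)"
  unfolding ode_solution_def
proof (intro conjI ballI)
  show "sq_integrable (\<lambda>x. c *s h x)"
    using assms sq_integrable_bounded_linear[OF _ bounded_linear_scale_vec] unfolding ode_solution_def by blast
  fix x :: real assume x: "x \<in> {0..1}"
  show "((\<lambda>x. c *s F x) has_vector_derivative c *s F' x) (at x within {0..1})"
    using assms x bounded_linear.has_vector_derivative[OF bounded_linear_scale_vec]
    unfolding ode_solution_def by blast
  have i: "F' x = F' 0 + integral {0..x} (\<lambda>t. M *v F t + h t)"
    using assms x unfolding ode_solution_def by blast
  have "integral {0..x} (\<lambda>t. M *v (c *s F t) + c *s h t) = integral {0..x} (\<lambda>t. c *s (M *v F t + h t))"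
    by (simp add: vector_add_ldistrib vector_scalar_commute)
  also have "\<dots> = c *s integral {0..x} (\<lambda>t. M *v F t + h t)"
    using integral_linear[OF integrable_unit_leb_subinterval[OF sq_integrable_imp_integrable[OF
            ode_solution_sq_integrable(2)[OF assms]] x] bounded_linear_scale_vec[of c]]
    by (simp add: o_def)
  finally show "c *s F' x = c *s F' 0 + integral {0..x} (\<lambda>t. M *v (c *s F t) + c *s h t)"
    by (subst i) (simp add: vector_add_ldistrib)
qed

text \<open>Continuity upgrades vanishing almost everywhere to vanishing on the closed interval, in
  particular at 0, where initial data are read off.\<close>

lemma continuous_represents_0:
  assumes "represented_by 0 F" "continuous_on {0..1} F" "x \<in> {0..1}"
  shows "F x = 0"
proof -
  have c: "continuous_on {0..1} (\<lambda>x. (norm (F x))\<^sup>2)" by (intro continuous_intros assms)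
  have "integral {0..1} (\<lambda>x. (norm (F x))\<^sup>2) = 0"
    using norm_represented_by[OF assms(1)] integrable_unit_leb_integral(2)[OF continuous_integrable_unit_leb[OF c]]
    by simp
  then show ?thesis
    using assms(3) c by (subst (asm) integral_eq_0_iff) auto
qed

text \<open>A shooting argument: the conditions at 0 leave two free complex initial data and the
  conditions at 1 impose two linear equations on them. Injectivity of the operator makes this square
  system injective, hence solvable.\<close>

lemma op_AD_minus_scaleC_surj:
  assumes A': "A ** A' = mat 1"
    and inj: "\<And>f. f \<in> Dom_D \<Longrightarrow> op_AD A f - scaleC_L2 z f = 0 \<Longrightarrow> f = 0"
  shows "\<exists>f\<in>Dom_D. op_AD A f - scaleC_L2 z f = g"
proof -
  \<comment> \<open>Solving - A F'' - z F = h for F'' gives F'' = - A' (z F + h), that is, M F - A'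
    h.\<close>
  define M :: "complex^2^2" where "M = (\<chi> i j. - z * A' $ i $ j)"
  have M: "M *v v = - (A' *v (z *s v))" for v
    by (simp add: vec_eq_iff M_def matrix_vector_mult_def sum_negf[symmetric] mult_ac)
  have AA': "A *v (A' *v v) = v" for v
    by (simp add: matrix_vector_mul_assoc A')
  have neg: "X *v (- v) = - (X *v v)" for X :: "complex^2^2" and v
    by (rule linear_neg[OF bounded_linear.linear[OF bounded_linear_matrix_vec]])
  have sol: "\<exists>f\<in>Dom_D. op_AD A f - scaleC_L2 z f = k \<and> represented_by f F"
    if s: "ode_solution M (\<lambda>x. - (A' *v h x)) F F'" and k: "represented_by k h"
      and bc: "F 0 $ 1 = 0" "F 1 $ 1 = 0" "F' 0 $ 2 = 0" "F' 1 $ 2 = 0" for F F' h k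
  proof -
    let ?G = "\<lambda>t. M *v F t + - (A' *v h t)"
    have f: "represented_by (abs_L2 F) F"
      by (rule represented_by_abs[OF ode_solution_sq_integrable(1)[OF s]])
    have r: "Dom_D_rep (abs_L2 F) F F' ?G"
      using s f bc ode_solution_sq_integrable(2)[OF s] unfolding Dom_D_rep_def ode_solution_def by blast
    have "op_AD A (abs_L2 F) - scaleC_L2 z (abs_L2 F) = k"
      unfolding op_AD_def op_D_def
      by (rule represented_by_eqI, (rule represented_by_intros Dom_D_repD(2)[OF r] f)+, rule k)
        (simp add: M neg matrix_vector_right_distrib AA' matrix_vector_mult_diff_distrib)
    then show ?thesis using Dom_D_repD(1)[OF r] f by blast
  qed
  obtain h where h: "represented_by g h" by (rule represented_by_ex)
  have sq: "sq_integrable (\<lambda>x. - (A' *v h x))"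
    by (intro sq_integrable_minus sq_integrable_bounded_linear[OF _ bounded_linear_matrix_vec]
        represented_by_sq_integrable[OF h])
  obtain F F' where F: "ode_solution M (\<lambda>x. - (A' *v h x)) F F'" "F 0 = 0" "F' 0 = 0"
    using ode_solution_exists[OF sq] by blast
  \<comment> \<open>Free at 0 are the second component of the value and the first component of the
    derivative; \<open>\<phi>\<close> and \<open>\<psi>\<close> switch on one each.\<close>
  obtain \<phi> \<phi>' where \<phi>: "ode_solution M (\<lambda>x. 0) \<phi> \<phi>'" "\<phi> 0 = axis 2 1" "\<phi>' 0 = 0"
    using ode_solution_exists[OF sq_integrable_0] by blast
  obtain \<psi> \<psi>' where \<psi>: "ode_solution M (\<lambda>x. 0) \<psi> \<psi>'" "\<psi> 0 = 0" "\<psi>' 0 = axis 1 1"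
    using ode_solution_exists[OF sq_integrable_0] by blast
  \<comment> \<open>\<open>N\<close> maps the free data to the two quantities that have to vanish at
    1.\<close>
  define N :: "complex^2^2" where
    "N = vector [vector [\<phi> 1 $ 1, \<psi> 1 $ 1], vector [\<phi>' 1 $ 2, \<psi>' 1 $ 2]]"
  have N: "(N *v v) $ 1 = v $ 1 * \<phi> 1 $ 1 + v $ 2 * \<psi> 1 $ 1"
    "(N *v v) $ 2 = v $ 1 * \<phi>' 1 $ 2 + v $ 2 * \<psi>' 1 $ 2" for v
    by (simp_all add: N_def matrix_vector_mult_def sum_2 mult.commute)
  have hom: "ode_solution M (\<lambda>x. 0) (\<lambda>x. a *s \<phi> x + b *s \<psi> x) (\<lambda>x. a *s \<phi>' x + b *s \<psi>' x)" for a b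
    using ode_solution_add[OF ode_solution_scale[OF \<phi>(1), of a] ode_solution_scale[OF \<psi>(1), of b]] by simp
  \<comment> \<open>A kernel vector yields a homogeneous solution in \<open>Dom_D\<close>. By
    \<open>inj\<close> it is zero in \<open>L2\<close>, hence pointwise, and so are its initial
    data, the entries of the vector.\<close>
  have N_inj: "v = 0" if v: "N *v v = 0" for v
  proof -
    let ?E = "\<lambda>x. v $ 1 *s \<phi> x + v $ 2 *s \<psi> x" and ?E' = "\<lambda>x. v $ 1 *s \<phi>' x + v $ 2 *s \<psi>' x"
    have s: "ode_solution M (\<lambda>x. - (A' *v 0)) ?E ?E'" using hom by simp
    have "represented_by 0 (\<lambda>x. 0)"
      by (simp add: represented_by_iff sq_integrable_0 zero_L2_def)
    then have "\<exists>f\<in>Dom_D. op_AD A f - scaleC_L2 z f = 0 \<and> represented_by f ?E"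
      using N[of v] v \<phi>(2,3) \<psi>(2,3) by (intro sol[OF s]) (auto simp: axis_def)
    then have r: "represented_by 0 ?E" using inj by blast
    have d: "has_deriv_unit ?E ?E'" using hom unfolding ode_solution_def by blast
    have E0: "?E x = 0" if "x \<in> {0..1}" for x
      by (rule continuous_represents_0[OF r has_deriv_unit_continuous[OF d] that])
    \<comment> \<open>Uniqueness of the one-sided derivative at 0 gives \<open>?E' 0 = 0\<close>,
      which isolates the coefficient of \<open>\<psi>\<close>.\<close>
    have "(?E has_vector_derivative 0) (at 0 within {0..1})"
      by (rule has_vector_derivative_transform[OF _ E0 has_vector_derivative_const]) auto
    moreover have "(?E has_vector_derivative ?E' 0) (at 0 within {0..1})"
      using d by auto
    ultimately have "?E' 0 = 0"
      by (intro vector_derivative_unique_within[of 0 "{0..1}" ?E]) (simp_all add: at_within_Icc_at_right)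
    then have "v $ 2 = 0" using \<phi>(3) \<psi>(3) by (simp add: vec_eq_iff forall_2 axis_def)
    moreover have "v $ 1 = 0" using E0[of 0] \<phi>(2) \<psi>(2) by (simp add: vec_eq_iff forall_2 axis_def)
    ultimately show "v = 0" by (simp add: vec_eq_iff forall_2)
  qed
  have "inj ((*v) N)"
  proof (rule injI)
    fix v w assume "N *v v = N *v w"
    then have "N *v (v - w) = 0" by (simp add: matrix_vector_mult_diff_distrib)
    from N_inj[OF this] show "v = w" by simp
  qed
  then obtain N' where "N' ** N = mat 1"
    using matrix_left_invertible_injective[of N] by auto
  then have "N ** N' = mat 1"
    by (rule matrix_left_right_inverse[THEN iffD1])
  then have NN': "N *v (N' *v w) = w" for w
    by (simp add: matrix_vector_mul_assoc)
  \<comment> \<open>These coefficients cancel the boundary values that the particular solution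
    \<open>F\<close> leaves at 1.\<close>
  define v where "v = N' *v (- vector [F 1 $ 1, F' 1 $ 2])"
  have Nv: "N *v v = - vector [F 1 $ 1, F' 1 $ 2]" by (simp only: v_def NN')
  have bc: "v $ 1 * \<phi> 1 $ 1 + v $ 2 * \<psi> 1 $ 1 = - F 1 $ 1"
    "v $ 1 * \<phi>' 1 $ 2 + v $ 2 * \<psi>' 1 $ 2 = - F' 1 $ 2"
    using N[of v] by (simp_all add: Nv)
  have "ode_solution M (\<lambda>x. - (A' *v h x))
      (\<lambda>x. F x + (v $ 1 *s \<phi> x + v $ 2 *s \<psi> x)) (\<lambda>x. F' x + (v $ 1 *s \<phi>' x + v $ 2 *s \<psi>' x))"
    using ode_solution_add[OF F(1) hom[of "v $ 1" "v $ 2"]] by simp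
  from sol[OF this h] show ?thesis
    using F(2,3) \<phi>(2,3) \<psi>(2,3) bc by (auto simp: axis_def)
qed

section \<open>The resolvent outside the sectors\<close>

lemma resolvent_off_sectors:
  assumes R: "real_diagonal B" "invertible B"
    and s: "matrix_norm (A ** B - mat 1) < 1"
    and \<delta>: "matrix_norm (A ** B - mat 1) * cmod z < \<bar>Im z\<bar>"
  shows "z \<in> resolvent_set Dom_D (op_AD A)"
    "onorm (resolvent Dom_D (op_AD A) z) \<le> 1 / (\<bar>Im z\<bar> - matrix_norm (A ** B - mat 1) * cmod z)"
proof -
  define \<delta> where "\<delta> = \<bar>Im z\<bar> - matrix_norm (A ** B - mat 1) * cmod z"
  define T where "T = (\<lambda>f. op_AD A f - scaleC_L2 z f)"
  have \<delta>0: "\<delta> > 0" using \<delta> by (simp add: \<delta>_def)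
  have est: "\<delta> * norm f \<le> norm (T f)" if "f \<in> Dom_D" for f
    unfolding \<delta>_def T_def by (rule resolvent_estimate[OF R that])
  have add: "f + e \<in> Dom_D" "T (f + e) = T f + T e" if "f \<in> Dom_D" "e \<in> Dom_D" for f e
    using weak_deriv2_add(1)[OF that] op_AD_add[OF that] linear_add[OF linear_scaleC_L2, of z f e]
    by (simp_all add: T_def)
  have scale: "c *\<^sub>R f \<in> Dom_D" "T (c *\<^sub>R f) = c *\<^sub>R T f" if "f \<in> Dom_D" for c f
    using weak_deriv2_scaleR(1)[OF that] op_AD_scaleR[OF that] linear_scale[OF linear_scaleC_L2, of z c f]
    by (simp_all add: T_def scaleR_diff_right)
  have ker: "f = 0" if "f \<in> Dom_D" "T f = 0" for f
    using est[OF that(1)] that(2) \<delta>0 by (simp add: mult_le_0_iff)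
  have inj: "inj_on T Dom_D"
  proof (rule inj_onI)
    fix f e assume fe: "f \<in> Dom_D" "e \<in> Dom_D" "T f = T e"
    have "T (f + (-1) *\<^sub>R e) = 0"
      using fe add(2)[OF fe(1) scale(1)[OF fe(2), of "-1"]] scale(2)[OF fe(2), of "-1"] by simp
    then have "f + (-1) *\<^sub>R e = 0"
      by (rule ker[OF add(1)[OF fe(1) scale(1)[OF fe(2)]]])
    then show "f = e" by simp
  qed
  \<comment> \<open>If \<open>A ** B\<close> identifies two vectors, \<open>A ** B - mat 1\<close>
    maps their difference to its negative; a norm below 1 allows this only for 0. Hence
    \<open>A\<close> has the right inverse \<open>B ** X\<close>, which the reduction to an ODE
    requires.\<close>
  have "\<exists>X. X ** (A ** B) = mat 1"
    unfolding matrix_left_invertible_injective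
  proof (rule injI)
    fix v w assume "(A ** B) *v v = (A ** B) *v w"
    then have "(A ** B - mat 1) *v (v - w) = - (v - w)"
      by (simp add: matrix_vector_mult_diff_rdistrib matrix_vector_mult_diff_distrib)
    then have "norm (v - w) \<le> matrix_norm (A ** B - mat 1) * norm (v - w)"
      using norm_matrix_vec_le[of "A ** B - mat 1" "v - w"] by (simp only: norm_minus_cancel)
    then have "norm (v - w) * (1 - matrix_norm (A ** B - mat 1)) \<le> 0"
      by (simp add: algebra_simps)
    then show "v = w" using s by (simp add: mult_le_0_iff)
  qed
  then obtain X where "X ** (A ** B) = mat 1" by blast
  then have "(A ** B) ** X = mat 1" by (rule matrix_left_right_inverse[THEN iffD1])
  then have A': "A ** (B ** X) = mat 1" by (simp add: matrix_mul_assoc)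
  have "\<exists>f\<in>Dom_D. T f = g" for g
    unfolding T_def by (rule op_AD_minus_scaleC_surj[OF A' ker[unfolded T_def]])
  then have surj: "T ` Dom_D = UNIV"
    by (metis UNIV_eq_I imageI)
  have bij: "bij_betw T Dom_D UNIV"
    using inj surj by (simp add: bij_betw_def)
  define r where "r = inv_into Dom_D T"
  have r: "r g \<in> Dom_D" "T (r g) = g" for g
    using inv_into_into[of g T Dom_D] f_inv_into_f[of g T Dom_D] surj by (simp_all add: r_def)
  have rT: "r (T f) = f" if "f \<in> Dom_D" for f
    unfolding r_def by (rule inv_into_f_f[OF inj that])
  have bound: "norm (r g) \<le> 1 / \<delta> * norm g" for g
    using est[OF r(1)[of g]] \<delta>0 by (simp add: r(2) field_simps)
  have "bounded_linear r"
  proof (rule bounded_linear_intro)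
    show "r (g + h) = r g + r h" for g h
      using rT[OF add(1)[OF r(1) r(1)], of g h] by (simp add: add(2) r)
    show "r (c *\<^sub>R g) = c *\<^sub>R r g" for c g
      using rT[OF scale(1)[OF r(1)], of c g] by (simp add: scale(2) r)
    show "norm (r g) \<le> norm g * (1 / \<delta>)" for g
      using bound[of g] by (simp add: mult.commute)
  qed
  moreover have res: "resolvent Dom_D (op_AD A) z = r"
    by (simp add: resolvent_def r_def T_def)
  ultimately show "z \<in> resolvent_set Dom_D (op_AD A)"
    using bij by (simp add: resolvent_set_def T_def)
  show "onorm (resolvent Dom_D (op_AD A) z) \<le> 1 / (\<bar>Im z\<bar> - matrix_norm (A ** B - mat 1) * cmod z)"
    unfolding res \<delta>_def[symmetric] using \<delta>0 bound by (intro onorm_bound) auto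
qed

theorem theorem13:
  fixes A B :: "complex^2^2" and \<omega> :: real
  assumes "real_diagonal B" and "invertible B"
    and "matrix_norm (A ** B - mat 1) < 1"
    and "\<omega> = arcsin (matrix_norm (A ** B - mat 1))"
  shows "Spec Dom_D (op_AD A) \<subseteq> sector (- \<omega>) \<omega> \<union> sector (- pi - \<omega>) (\<omega> - pi)
    \<and> (\<exists>\<epsilon>\<^sub>0>0. \<forall>\<epsilon>. 0 < \<epsilon> \<and> \<epsilon> < \<epsilon>\<^sub>0 \<longrightarrow>
         (\<exists>k>0. \<forall>z. z \<notin> sector (- \<omega> - \<epsilon>) (\<omega> + \<epsilon>) \<union> sector (- pi - \<omega> - \<epsilon>) (\<omega> - pi + \<epsilon>) \<longrightarrow>
            z \<in> resolvent_set Dom_D (op_AD A) \<and>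
            onorm (resolvent Dom_D (op_AD A) z) \<le> k / cmod z))"
proof -
  define s where "s = matrix_norm (A ** B - mat 1)"
  have s: "0 \<le> s" "s < 1" using assms(3) by (simp_all add: s_def matrix_norm_nonneg)
  have sin: "sin \<omega> = s" using s by (simp add: assms(4) s_def[symmetric])
  have \<omega>: "0 \<le> \<omega>" "\<omega> < pi / 2"
    using s arcsin_le_arcsin[of 0 s] arcsin_lt_bounded[of s] by (simp_all add: assms(4) s_def[symmetric])
  note res = resolvent_off_sectors[OF assms(1-3), folded s_def]
  have "z \<in> resolvent_set Dom_D (op_AD A)"
    if "z \<notin> sector (- \<omega>) \<omega> \<union> sector (- pi - \<omega>) (\<omega> - pi)" for z
    using res(1) abs_Im_gt_outside_sectors[OF \<omega> that] by (simp add: sin)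
  then have "Spec Dom_D (op_AD A) \<subseteq> sector (- \<omega>) \<omega> \<union> sector (- pi - \<omega>) (\<omega> - pi)"
    unfolding Spec_def by blast
  \<comment> \<open>Below \<open>pi / 2 - \<omega>\<close> the enlarged angle
    \<open>\<omega> + \<epsilon>\<close> stays acute, as the sector lemma and the monotonicity of
    sin require.\<close>
  moreover have "\<exists>k>0. \<forall>z. z \<notin> sector (- \<omega> - \<epsilon>) (\<omega> + \<epsilon>) \<union> sector (- pi - \<omega> - \<epsilon>) (\<omega> - pi + \<epsilon>) \<longrightarrow>
      z \<in> resolvent_set Dom_D (op_AD A) \<and> onorm (resolvent Dom_D (op_AD A) z) \<le> k / cmod z"
    if \<epsilon>: "0 < \<epsilon>" "\<epsilon> < pi / 2 - \<omega>" for \<epsilon>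
  proof -
    \<comment> \<open>Outside the enlarged sectors \<open>\<bar>Im z\<bar>\<close> exceeds
      \<open>sin (\<omega> + \<epsilon>) * cmod z\<close>, so the factor in the resolvent estimate
      exceeds \<open>d * cmod z\<close>; hence \<open>1 / d\<close> serves as
      \<open>k\<close>.\<close>
    define d where "d = sin (\<omega> + \<epsilon>) - s"
    have d: "d > 0"
      using sin_monotone_2pi[of \<omega> "\<omega> + \<epsilon>"] \<omega> \<epsilon> by (simp add: d_def sin)
    have "z \<in> resolvent_set Dom_D (op_AD A) \<and> onorm (resolvent Dom_D (op_AD A) z) \<le> (1 / d) / cmod z"
      if z: "z \<notin> sector (- \<omega> - \<epsilon>) (\<omega> + \<epsilon>) \<union> sector (- pi - \<omega> - \<epsilon>) (\<omega> - pi + \<epsilon>)" for z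
    proof -
      have eq: "- \<omega> - \<epsilon> = - (\<omega> + \<epsilon>)" "- pi - \<omega> - \<epsilon> = - pi - (\<omega> + \<epsilon>)" "\<omega> - pi + \<epsilon> = (\<omega> + \<epsilon>) - pi"
        by simp_all
      have "sin (\<omega> + \<epsilon>) * cmod z < \<bar>Im z\<bar>"
        using \<omega> \<epsilon> z unfolding eq by (intro abs_Im_gt_outside_sectors) auto
      then have le: "d * cmod z < \<bar>Im z\<bar> - s * cmod z"
        by (simp add: d_def algebra_simps)
      then have z0: "cmod z > 0" by auto
      have pos: "s * cmod z < \<bar>Im z\<bar>"
        using le mult_pos_pos[OF d z0] by linarith
      have "1 / (\<bar>Im z\<bar> - s * cmod z) \<le> 1 / (d * cmod z)"
        using le mult_pos_pos[OF d z0] by (intro frac_le) auto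
      then show ?thesis
        using res[OF pos] by (auto simp: field_simps)
    qed
    then show ?thesis
      using d by (intro exI[of _ "1 / d"]) auto
  qed
  ultimately show ?thesis
    using \<omega> by (intro conjI exI[of _ "pi / 2 - \<omega>"]) auto
qed

end
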